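(* Let $P$ be a symmetric operad in $\mathbf{Set}$. Let $(\Phi,\phi)$ be any signature for $P$, and let $Q$ be the categorification of $P$ with respect to $(\Phi,\phi)$. Then $Q$ is equivalent to the unbiased categorification $\mathrm{Wk}(P)$ of $P$ as a symmetric $\mathbf{Cat}$-operad, i.e. $Q$ and $\mathrm{Wk}(P)$ are equivalent objects of the 2-category $\mathbf{Cat}\text{-}\Sigma\text{-}\mathbf{Operad}$.
   Context: Natural numbers include $0$. Symmetric operads. A symmetric operad $P$ in $\mathbf{Set}$ consists of sets $P_0,P_1,P_2,\dots$, composition functions $\circ: P_n\times P_{k_1}\times\cdots\times P_{k_n}\to P_{k_1+\cdots+k_n}$ for all $n,k_1,\dots,k_n\in\mathbb{N}$, a unit $1\in P_1$, and a left action of the symmetric group $S_n$ on each $P_n$, such that composition is associative, $1\circ f=f=f\circ(1,\dots,1)$, and composition is equivariant in the usual sense: $(\sigma\cdot f)\circ(g_1,\dots,g_n)=\hat\sigma\cdot\big(f\circ(g_{\sigma(1)},\dots,g_{\sigma(n)})\big)$, where $\hat\sigma$ is the block permutation sending the $j$-th position of the $i$-th block (of size $k_{\sigma(i)}$) to the $j$-th position of the $\sigma(i)$-th block in the ordering with block sizes $k_1,\dots,k_n$; and $f\circ(\sigma_1\cdot g_1,\dots,\sigma_n\cdot g_n)=(\sigma_1\oplus\cdots\oplus\sigma_n)\cdot(f\circ(g_1,\dots,g_n))$. A morphism $f:P\to Q$ is a sequence of functions $f_n:P_n\to Q_n$ preserving composition, unit and the symmetric group actions. The resulting category is $\Sigma\text{-}\mathbf{Operad}$.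 Symmetric $\mathbf{Cat}$-operads and their morphisms are defined in the same way internally to $\mathbf{Cat}$ with its finite products: each $P_n$ is a (small) category, composition and the actions of the elements of $S_n$ are functors, the unit is an object of $P_1$, the axioms hold strictly, and morphisms are sequences of functors preserving all the structure strictly. A morphism $f$ is "levelwise $X$" if every $f_n$ has property $X$. Transformations. For morphisms $f,g:P\to Q$ of symmetric $\mathbf{Cat}$-operads, a transformation $\alpha:f\to g$ is a sequence of natural transformations $\alpha_n:f_n\to g_n$ such that (on components at objects) $(\alpha_{k_1+\cdots+k_n})_{p\circ(p_1,\dots,p_n)}=(\alpha_n)_p\circ\big((\alpha_{k_1})_{p_1},\dots,(\alpha_{k_n})_{p_n}\big)$, $(\alpha_1)_1=\mathrm{id}_1$, and $(\alpha_n)_{\sigma\cdot p}=\sigma\cdot(\alpha_n)_p$ for all $\sigma\in S_n$. Symmetric $\mathbf{Cat}$-operads, morphisms and transformations form a 2-category $\mathbf{Cat}\text{-}\Sigma\text{-}\mathbf{Operad}$. The category $\Sigma\text{-}\mathbf{Operad}$ is embedded in it fully and faithfully by regarding each set $P_n$ as a discrete category. Signatures. Let $U:\Sigma\text{-}\mathbf{Operad}\to\mathbf{Set}^{\mathbb{N}}$ be the forgetful functor (which is monadic) and $F$ its left adjoint. A signature for $P$ is a pair $(\Phi,\phi)$ with $\Phi\in\mathbf{Set}^{\mathbb{N}}$ and $\phi:F\Phi\to P$ a regular epimorphism in $\Sigma\text{-}\mathbf{Operad}$. The pair $(UP,\epsilon)$, with $\epsilon:FUP\to P$ the counit of $F\dashv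 U$, is a signature for $P$. Categorification. On the category of symmetric $\mathbf{Cat}$-operads there is a factorization system whose left class consists of the morphisms that are levelwise bijective on objects and whose right class consists of the morphisms that are levelwise full and faithful. Given a signature $(\Phi,\phi)$ for $P$, regard $\phi$ as a morphism of symmetric $\mathbf{Cat}$-operads and factor it as $F\Phi\xrightarrow{\,b\,}Q\xrightarrow{\,f\,}P$ with $b$ levelwise bijective on objects and $f$ levelwise full and faithful. The symmetric $\mathbf{Cat}$-operad $Q$, which is unique up to isomorphism, is the categorification of $P$ with respect to $(\Phi,\phi)$. The unbiased categorification $\mathrm{Wk}(P)$ is the categorification of $P$ with respect to $(UP,\epsilon)$. *)

theory Defs
  imports Main "HOL-Combinatorics.Permutations"
begin

section \<open>Block permutations\<close>

text \<open>
  Positions are counted from 0, and the symmetric group \<open>S\<^sub>n\<close> is the set of functions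
  \<open>\<sigma> :: nat \<Rightarrow> nat\<close> with \<open>\<sigma> permutes {..<n}\<close>.
  For block sizes \<open>ks\<close>, the \<open>i\<close>-th block starts at position \<open>block_start ks i\<close>.
\<close>

definition block_start :: "nat list \<Rightarrow> nat \<Rightarrow> nat" where
  "block_start ks i = sum_list (take i ks)"

text \<open>
  Both permutations are given by the list of their values at \<open>0, 1, 2, \<dots>\<close>, block by block;
  see \<open>block_perm_apply\<close> and \<open>block_sum_apply\<close> below for the usual description.
\<close>

definition block_perm :: "nat list \<Rightarrow> (nat \<Rightarrow> nat) \<Rightarrow> nat \<Rightarrow> nat" where
  "block_perm ks \<sigma> p =
    (if p < sum_list ks
     then concat (map (\<lambda>i. map (\<lambda>j. block_start ks (\<sigma> i) + j) [0..<ks ! \<sigma> i]) [0..<length ks]) ! p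
     else p)"

definition block_sum :: "nat list \<Rightarrow> (nat \<Rightarrow> nat) list \<Rightarrow> nat \<Rightarrow> nat" where
  "block_sum ks \<sigma>s p =
    (if p < sum_list ks
     then concat (map (\<lambda>i. map (\<lambda>j. block_start ks i + (\<sigma>s ! i) j) [0..<ks ! i]) [0..<length ks]) ! p
     else p)"


section \<open>Symmetric operads in sets\<close>

text \<open>
  The sets \<open>Ops P n\<close> need not be disjoint, so composition carries the arities
  \<open>ks = [k\<^sub>1, \<dots>, k\<^sub>n]\<close> of its inputs and the action carries the arity.
\<close>

record 'a operad =
  Ops :: "nat \<Rightarrow> 'a set"
  Compose :: "nat list \<Rightarrow> 'a \<Rightarrow> 'a list \<Rightarrow> 'a"
  Unit :: 'a
  Act :: "nat \<Rightarrow> (nat \<Rightarrow> nat) \<Rightarrow> 'a \<Rightarrow> 'a"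

locale sym_operad =
  fixes P :: "'a operad"
  assumes compose_closed:
    "\<lbrakk>f \<in> Ops P (length ks); list_all2 (\<lambda>k g. g \<in> Ops P k) ks gs\<rbrakk>
      \<Longrightarrow> Compose P ks f gs \<in> Ops P (sum_list ks)"
  and unit_closed: "Unit P \<in> Ops P 1"
  and act_closed: "\<lbrakk>\<sigma> permutes {..<n}; f \<in> Ops P n\<rbrakk> \<Longrightarrow> Act P n \<sigma> f \<in> Ops P n"
  and act_id: "f \<in> Ops P n \<Longrightarrow> Act P n id f = f"
  and act_comp:
    "\<lbrakk>\<sigma> permutes {..<n}; \<tau> permutes {..<n}; f \<in> Ops P n\<rbrakk>
      \<Longrightarrow> Act P n (\<sigma> \<circ> \<tau>) f = Act P n \<sigma> (Act P n \<tau> f)"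
  and assoc:
    "\<lbrakk>f \<in> Ops P (length lss);
      list_all2 (\<lambda>ls g. g \<in> Ops P (length ls)) lss gs;
      list_all2 (list_all2 (\<lambda>l h. h \<in> Ops P l)) lss hss\<rbrakk>
      \<Longrightarrow> Compose P (concat lss) (Compose P (map length lss) f gs) (concat hss) =
          Compose P (map sum_list lss) f
            (map (\<lambda>i. Compose P (lss ! i) (gs ! i) (hss ! i)) [0..<length lss])"
  and unit_left: "f \<in> Ops P n \<Longrightarrow> Compose P [n] (Unit P) [f] = f"
  and unit_right: "f \<in> Ops P n \<Longrightarrow> Compose P (replicate n 1) f (replicate n (Unit P)) = f"
  and equivariant_perm:
    "\<lbrakk>\<sigma> permutes {..<length ks}; f \<in> Ops P (length ks); list_all2 (\<lambda>k g. g \<in> Ops P k) ks gs\<rbrakk>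
      \<Longrightarrow> Compose P ks (Act P (length ks) \<sigma> f) gs =
          Act P (sum_list ks) (block_perm ks \<sigma>)
            (Compose P (permute_list \<sigma> ks) f (permute_list \<sigma> gs))"
  and equivariant_sum:
    "\<lbrakk>f \<in> Ops P (length ks); list_all2 (\<lambda>k g. g \<in> Ops P k) ks gs;
      list_all2 (\<lambda>k \<sigma>. \<sigma> permutes {..<k}) ks \<sigma>s\<rbrakk>
      \<Longrightarrow> Compose P ks f (map (\<lambda>i. Act P (ks ! i) (\<sigma>s ! i) (gs ! i)) [0..<length ks]) =
          Act P (sum_list ks) (block_sum ks \<sigma>s) (Compose P ks f gs)"

locale operad_morphism = P: sym_operad P + Q: sym_operad Q
  for P :: "'a operad" and Q :: "'b operad" +
  fixes f :: "nat \<Rightarrow> 'a \<Rightarrow> 'b"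
  assumes maps: "x \<in> Ops P n \<Longrightarrow> f n x \<in> Ops Q n"
  and pres_compose:
    "\<lbrakk>x \<in> Ops P (length ks); list_all2 (\<lambda>k y. y \<in> Ops P k) ks ys\<rbrakk>
      \<Longrightarrow> f (sum_list ks) (Compose P ks x ys) = Compose Q ks (f (length ks) x) (map2 f ks ys)"
  and pres_unit: "f 1 (Unit P) = Unit Q"
  and pres_act:
    "\<lbrakk>\<sigma> permutes {..<n}; x \<in> Ops P n\<rbrakk> \<Longrightarrow> f n (Act P n \<sigma> x) = Act Q n \<sigma> (f n x)"

text \<open>Equality of two morphisms with domain \<open>P\<close>; values outside the carriers are irrelevant.\<close>

definition fam_eq :: "'a operad \<Rightarrow> (nat \<Rightarrow> 'a \<Rightarrow> 'b) \<Rightarrow> (nat \<Rightarrow> 'a \<Rightarrow> 'b) \<Rightarrow> bool" where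
  "fam_eq P f g \<longleftrightarrow> (\<forall>n. \<forall>x\<in>Ops P n. f n x = g n x)"

text \<open>
  \<open>e : A \<rightarrow> B\<close> is a coequalizer of \<open>u, v : R \<rightarrow> A\<close>, where the universal property is tested
  against the operads \<open>Z\<close> whose carriers are subsets of the type \<open>'z\<close>.
\<close>

definition coequalizer ::
  "'z itself \<Rightarrow> 'r operad \<Rightarrow> 'a operad \<Rightarrow> 'b operad \<Rightarrow>
    (nat \<Rightarrow> 'r \<Rightarrow> 'a) \<Rightarrow> (nat \<Rightarrow> 'r \<Rightarrow> 'a) \<Rightarrow> (nat \<Rightarrow> 'a \<Rightarrow> 'b) \<Rightarrow> bool" where
  "coequalizer _ R A B u v e \<longleftrightarrow>
    operad_morphism R A u \<and> operad_morphism R A v \<and> operad_morphism A B e \<and>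
    fam_eq R (\<lambda>n. e n \<circ> u n) (\<lambda>n. e n \<circ> v n) \<and>
    (\<forall>(Z :: 'z operad) m.
      operad_morphism A Z m \<and> fam_eq R (\<lambda>n. m n \<circ> u n) (\<lambda>n. m n \<circ> v n) \<longrightarrow>
      (\<exists>k. operad_morphism B Z k \<and> fam_eq A (\<lambda>n. k n \<circ> e n) m \<and>
        (\<forall>k'. operad_morphism B Z k' \<and> fam_eq A (\<lambda>n. k' n \<circ> e n) m \<longrightarrow> fam_eq B k' k)))"

text \<open>
  Being a coequalizer quantifies over all operads, hence over all types, which HOL cannot
  express inside a definition. No generality is lost below: testing against the types \<open>'a set\<close>
  (quotients of \<open>A\<close>) and \<open>'b\<close> gives the universal property for every type
  (\<open>coequalizer_all_types\<close>), and a coequalizer of a pair out of an operad on any type is one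
  of a pair out of an operad on \<open>'a \<times> 'a\<close> (\<open>regular_epi_of_coequalizer\<close>).
\<close>

definition regular_epi :: "'a operad \<Rightarrow> 'b operad \<Rightarrow> (nat \<Rightarrow> 'a \<Rightarrow> 'b) \<Rightarrow> bool" where
  "regular_epi A B e \<longleftrightarrow>
    (\<exists>(R :: ('a \<times> 'a) operad) u v.
      coequalizer TYPE('a set) R A B u v e \<and> coequalizer TYPE('b) R A B u v e)"


section \<open>Free symmetric operads\<close>

text \<open>
  The free symmetric operad on \<open>\<Phi>\<close> consists of the formal operations built from \<open>\<Phi>\<close>,
  modulo the congruence generated by the operad axioms. Generators carry their arity because
  the sets \<open>\<Phi> n\<close> need not be disjoint. Freeness is proved below
  (\<open>free_operad_universal\<close>).
\<close>

datatype 's opterm =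
    TGen nat 's
  | TUnit
  | TCompose "nat list" "'s opterm" "'s opterm list"
  | TAct nat "nat \<Rightarrow> nat" "'s opterm"

inductive wt :: "(nat \<Rightarrow> 's set) \<Rightarrow> nat \<Rightarrow> 's opterm \<Rightarrow> bool" for \<Phi> where
  wt_gen: "s \<in> \<Phi> n \<Longrightarrow> wt \<Phi> n (TGen n s)"
| wt_unit: "wt \<Phi> 1 TUnit"
| wt_compose:
    "\<lbrakk>wt \<Phi> (length ks) t; list_all2 (wt \<Phi>) ks ts\<rbrakk> \<Longrightarrow> wt \<Phi> (sum_list ks) (TCompose ks t ts)"
| wt_act: "\<lbrakk>\<sigma> permutes {..<n}; wt \<Phi> n t\<rbrakk> \<Longrightarrow> wt \<Phi> n (TAct n \<sigma> t)"

inductive teq :: "(nat \<Rightarrow> 's set) \<Rightarrow> nat \<Rightarrow> 's opterm \<Rightarrow> 's opterm \<Rightarrow> bool" for \<Phi> where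
  teq_refl: "wt \<Phi> n t \<Longrightarrow> teq \<Phi> n t t"
| teq_sym: "teq \<Phi> n t u \<Longrightarrow> teq \<Phi> n u t"
| teq_trans: "\<lbrakk>teq \<Phi> n t u; teq \<Phi> n u v\<rbrakk> \<Longrightarrow> teq \<Phi> n t v"
| teq_compose:
    "\<lbrakk>teq \<Phi> (length ks) t u; length ts = length ks; length us = length ks;
      \<forall>i<length ks. teq \<Phi> (ks ! i) (ts ! i) (us ! i)\<rbrakk>
      \<Longrightarrow> teq \<Phi> (sum_list ks) (TCompose ks t ts) (TCompose ks u us)"
| teq_act:
    "\<lbrakk>\<sigma> permutes {..<n}; teq \<Phi> n t u\<rbrakk> \<Longrightarrow> teq \<Phi> n (TAct n \<sigma> t) (TAct n \<sigma> u)"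
| teq_act_id: "wt \<Phi> n t \<Longrightarrow> teq \<Phi> n (TAct n id t) t"
| teq_act_comp:
    "\<lbrakk>\<sigma> permutes {..<n}; \<tau> permutes {..<n}; wt \<Phi> n t\<rbrakk>
      \<Longrightarrow> teq \<Phi> n (TAct n (\<sigma> \<circ> \<tau>) t) (TAct n \<sigma> (TAct n \<tau> t))"
| teq_assoc:
    "\<lbrakk>wt \<Phi> (length lss) t;
      list_all2 (\<lambda>ls. wt \<Phi> (length ls)) lss us;
      list_all2 (list_all2 (wt \<Phi>)) lss vss\<rbrakk>
      \<Longrightarrow> teq \<Phi> (sum_list (concat lss))
            (TCompose (concat lss) (TCompose (map length lss) t us) (concat vss))
            (TCompose (map sum_list lss) t
              (map (\<lambda>i. TCompose (lss ! i) (us ! i) (vss ! i)) [0..<length lss]))"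
| teq_unit_left: "wt \<Phi> n t \<Longrightarrow> teq \<Phi> n (TCompose [n] TUnit [t]) t"
| teq_unit_right:
    "wt \<Phi> n t \<Longrightarrow> teq \<Phi> n (TCompose (replicate n 1) t (replicate n TUnit)) t"
| teq_equivariant_perm:
    "\<lbrakk>\<sigma> permutes {..<length ks}; wt \<Phi> (length ks) t; list_all2 (wt \<Phi>) ks us\<rbrakk>
      \<Longrightarrow> teq \<Phi> (sum_list ks)
            (TCompose ks (TAct (length ks) \<sigma> t) us)
            (TAct (sum_list ks) (block_perm ks \<sigma>)
              (TCompose (permute_list \<sigma> ks) t (permute_list \<sigma> us)))"
| teq_equivariant_sum:
    "\<lbrakk>wt \<Phi> (length ks) t; list_all2 (wt \<Phi>) ks us;
      list_all2 (\<lambda>k \<sigma>. \<sigma> permutes {..<k}) ks \<sigma>s\<rbrakk>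
      \<Longrightarrow> teq \<Phi> (sum_list ks)
            (TCompose ks t (map (\<lambda>i. TAct (ks ! i) (\<sigma>s ! i) (us ! i)) [0..<length ks]))
            (TAct (sum_list ks) (block_sum ks \<sigma>s) (TCompose ks t us))"

definition teq_rel :: "(nat \<Rightarrow> 's set) \<Rightarrow> nat \<Rightarrow> 's opterm rel" where
  "teq_rel \<Phi> n = {(t, u). teq \<Phi> n t u}"

definition tclass :: "(nat \<Rightarrow> 's set) \<Rightarrow> nat \<Rightarrow> 's opterm \<Rightarrow> 's opterm set" where
  "tclass \<Phi> n t = teq_rel \<Phi> n `` {t}"

definition trep :: "'s opterm set \<Rightarrow> 's opterm" where
  "trep X = (SOME t. t \<in> X)"

definition free_operad :: "(nat \<Rightarrow> 's set) \<Rightarrow> 's opterm set operad" where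
  "free_operad \<Phi> =
    \<lparr>Ops = (\<lambda>n. {t. wt \<Phi> n t} // teq_rel \<Phi> n),
     Compose = (\<lambda>ks X Ys. tclass \<Phi> (sum_list ks) (TCompose ks (trep X) (map trep Ys))),
     Unit = tclass \<Phi> 1 TUnit,
     Act = (\<lambda>n \<sigma> X. tclass \<Phi> n (TAct n \<sigma> (trep X)))\<rparr>"

definition free_gen :: "(nat \<Rightarrow> 's set) \<Rightarrow> nat \<Rightarrow> 's \<Rightarrow> 's opterm set" where
  "free_gen \<Phi> n s = tclass \<Phi> n (TGen n s)"

primrec eval :: "'a operad \<Rightarrow> (nat \<Rightarrow> 's \<Rightarrow> 'a) \<Rightarrow> 's opterm \<Rightarrow> 'a" where
  "eval P h (TGen n s) = h n s"
| "eval P h TUnit = Unit P"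
| "eval P h (TCompose ks t ts) = Compose P ks (eval P h t) (map (eval P h) ts)"
| "eval P h (TAct n \<sigma> t) = Act P n \<sigma> (eval P h t)"

definition free_ext :: "'a operad \<Rightarrow> (nat \<Rightarrow> 's \<Rightarrow> 'a) \<Rightarrow> nat \<Rightarrow> 's opterm set \<Rightarrow> 'a" where
  "free_ext P h n X = eval P h (trep X)"

text \<open>The counit at \<open>P\<close> of the free-forgetful adjunction is the extension of the identity.\<close>

definition counit :: "'a operad \<Rightarrow> nat \<Rightarrow> 'a opterm set \<Rightarrow> 'a" where
  "counit P = free_ext P (\<lambda>n x. x)"

definition signature ::
  "'p operad \<Rightarrow> (nat \<Rightarrow> 's set) \<Rightarrow> (nat \<Rightarrow> 's opterm set \<Rightarrow> 'p) \<Rightarrow> bool" where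
  "signature P \<Phi> \<phi> \<longleftrightarrow> regular_epi (free_operad \<Phi>) P \<phi>"


section \<open>Small categories\<close>

record ('o, 'm) cat =
  Obj :: "'o set"
  Arr :: "'m set"
  Dom :: "'m \<Rightarrow> 'o"
  Cod :: "'m \<Rightarrow> 'o"
  Id :: "'o \<Rightarrow> 'm"
  Cmp :: "'m \<Rightarrow> 'm \<Rightarrow> 'm"  \<comment> \<open>\<open>Cmp C g f\<close> is \<open>f\<close> followed by \<open>g\<close>\<close>

definition Hom :: "('o, 'm) cat \<Rightarrow> 'o \<Rightarrow> 'o \<Rightarrow> 'm set" where
  "Hom C x y = {f \<in> Arr C. Dom C f = x \<and> Cod C f = y}"

locale category =
  fixes C :: "('o, 'm) cat"
  assumes dom_closed: "f \<in> Arr C \<Longrightarrow> Dom C f \<in> Obj C"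
  and cod_closed: "f \<in> Arr C \<Longrightarrow> Cod C f \<in> Obj C"
  and id_closed: "x \<in> Obj C \<Longrightarrow> Id C x \<in> Hom C x x"
  and cmp_closed: "\<lbrakk>f \<in> Hom C x y; g \<in> Hom C y z\<rbrakk> \<Longrightarrow> Cmp C g f \<in> Hom C x z"
  and cmp_id_left: "f \<in> Hom C x y \<Longrightarrow> Cmp C (Id C y) f = f"
  and cmp_id_right: "f \<in> Hom C x y \<Longrightarrow> Cmp C f (Id C x) = f"
  and cmp_assoc:
    "\<lbrakk>f \<in> Hom C w x; g \<in> Hom C x y; h \<in> Hom C y z\<rbrakk>
      \<Longrightarrow> Cmp C (Cmp C h g) f = Cmp C h (Cmp C g f)"

locale cat_functor = C: category C + D: category D
  for C :: "('o, 'm) cat" and D :: "('o2, 'm2) cat" +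
  fixes Fo :: "'o \<Rightarrow> 'o2" and Fa :: "'m \<Rightarrow> 'm2"
  assumes obj_maps: "x \<in> Obj C \<Longrightarrow> Fo x \<in> Obj D"
  and arr_maps: "f \<in> Hom C x y \<Longrightarrow> Fa f \<in> Hom D (Fo x) (Fo y)"
  and pres_id: "x \<in> Obj C \<Longrightarrow> Fa (Id C x) = Id D (Fo x)"
  and pres_cmp:
    "\<lbrakk>f \<in> Hom C x y; g \<in> Hom C y z\<rbrakk> \<Longrightarrow> Fa (Cmp C g f) = Cmp D (Fa g) (Fa f)"

definition full_faithful ::
  "('o, 'm) cat \<Rightarrow> ('o2, 'm2) cat \<Rightarrow> ('o \<Rightarrow> 'o2) \<Rightarrow> ('m \<Rightarrow> 'm2) \<Rightarrow> bool" where
  "full_faithful C D Fo Fa \<longleftrightarrow>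
    (\<forall>x\<in>Obj C. \<forall>y\<in>Obj C. bij_betw Fa (Hom C x y) (Hom D (Fo x) (Fo y)))"

definition natural ::
  "('o, 'm) cat \<Rightarrow> ('o2, 'm2) cat \<Rightarrow> ('o \<Rightarrow> 'o2) \<Rightarrow> ('m \<Rightarrow> 'm2) \<Rightarrow>
    ('o \<Rightarrow> 'o2) \<Rightarrow> ('m \<Rightarrow> 'm2) \<Rightarrow> ('o \<Rightarrow> 'm2) \<Rightarrow> bool" where
  "natural C D Fo Fa Go Ga \<alpha> \<longleftrightarrow>
    (\<forall>x\<in>Obj C. \<alpha> x \<in> Hom D (Fo x) (Go x)) \<and>
    (\<forall>x y. \<forall>f\<in>Hom C x y. Cmp D (\<alpha> y) (Fa f) = Cmp D (Ga f) (\<alpha> x))"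

definition prod_cat ::
  "('o, 'm) cat \<Rightarrow> ('o2, 'm2) cat \<Rightarrow> ('o \<times> 'o2, 'm \<times> 'm2) cat" where
  "prod_cat C D =
    \<lparr>Obj = Obj C \<times> Obj D, Arr = Arr C \<times> Arr D,
     Dom = map_prod (Dom C) (Dom D), Cod = map_prod (Cod C) (Cod D),
     Id = map_prod (Id C) (Id D),
     Cmp = (\<lambda>(g, g') (f, f'). (Cmp C g f, Cmp D g' f'))\<rparr>"

definition list_cat :: "('o, 'm) cat list \<Rightarrow> ('o list, 'm list) cat" where
  "list_cat Cs =
    \<lparr>Obj = {xs. list_all2 (\<lambda>C x. x \<in> Obj C) Cs xs},
     Arr = {fs. list_all2 (\<lambda>C f. f \<in> Arr C) Cs fs},
     Dom = map2 Dom Cs, Cod = map2 Cod Cs, Id = map2 Id Cs,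
     Cmp = (\<lambda>gs fs. map (\<lambda>i. Cmp (Cs ! i) (gs ! i) (fs ! i)) [0..<length Cs])\<rparr>"


section \<open>Symmetric Cat-operads\<close>

record ('o, 'm) cat_operad =
  Lev :: "nat \<Rightarrow> ('o, 'm) cat"
  ComposeO :: "nat list \<Rightarrow> 'o \<Rightarrow> 'o list \<Rightarrow> 'o"
  ComposeA :: "nat list \<Rightarrow> 'm \<Rightarrow> 'm list \<Rightarrow> 'm"
  UnitO :: 'o
  ActO :: "nat \<Rightarrow> (nat \<Rightarrow> nat) \<Rightarrow> 'o \<Rightarrow> 'o"
  ActA :: "nat \<Rightarrow> (nat \<Rightarrow> nat) \<Rightarrow> 'm \<Rightarrow> 'm"

text \<open>
  The operad axioms of a Cat-operad are equations between functors, and two functors are equal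
  iff they agree on objects and on arrows. So the axioms say that the objects and the arrows
  each form a symmetric operad; the unit functor from the terminal category picks the object
  \<open>1\<close> and the arrow \<open>id\<^sub>1\<close>.
\<close>

definition obj_operad :: "('o, 'm) cat_operad \<Rightarrow> 'o operad" where
  "obj_operad P =
    \<lparr>Ops = (\<lambda>n. Obj (Lev P n)), Compose = ComposeO P, Unit = UnitO P, Act = ActO P\<rparr>"

definition arr_operad :: "('o, 'm) cat_operad \<Rightarrow> 'm operad" where
  "arr_operad P =
    \<lparr>Ops = (\<lambda>n. Arr (Lev P n)), Compose = ComposeA P, Unit = Id (Lev P 1) (UnitO P),
     Act = ActA P\<rparr>"

locale sym_cat_operad =
  fixes P :: "('o, 'm) cat_operad"
  assumes lev_category: "category (Lev P n)"
  and compose_functor: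
    "cat_functor (prod_cat (Lev P (length ks)) (list_cat (map (Lev P) ks))) (Lev P (sum_list ks))
      (\<lambda>(x, ys). ComposeO P ks x ys) (\<lambda>(f, gs). ComposeA P ks f gs)"
  and act_functor:
    "\<sigma> permutes {..<n} \<Longrightarrow> cat_functor (Lev P n) (Lev P n) (ActO P n \<sigma>) (ActA P n \<sigma>)"
  and obj_sym_operad: "sym_operad (obj_operad P)"
  and arr_sym_operad: "sym_operad (arr_operad P)"

record ('o, 'm, 'o2, 'm2) functor_family =
  onObj :: "nat \<Rightarrow> 'o \<Rightarrow> 'o2"
  onArr :: "nat \<Rightarrow> 'm \<Rightarrow> 'm2"

locale cat_operad_morphism = P: sym_cat_operad P + Q: sym_cat_operad Q
  for P :: "('o, 'm) cat_operad" and Q :: "('o2, 'm2) cat_operad" +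
  fixes F :: "('o, 'm, 'o2, 'm2) functor_family"
  assumes lev_functor: "cat_functor (Lev P n) (Lev Q n) (onObj F n) (onArr F n)"
  and obj_morphism: "operad_morphism (obj_operad P) (obj_operad Q) (onObj F)"
  and arr_morphism: "operad_morphism (arr_operad P) (arr_operad Q) (onArr F)"

definition id_morphism :: "('o, 'm, 'o, 'm) functor_family" where
  "id_morphism = \<lparr>onObj = (\<lambda>n x. x), onArr = (\<lambda>n f. f)\<rparr>"

definition comp_morphism ::
  "('o2, 'm2, 'o3, 'm3) functor_family \<Rightarrow> ('o, 'm, 'o2, 'm2) functor_family \<Rightarrow>
    ('o, 'm, 'o3, 'm3) functor_family" where
  "comp_morphism G F =
    \<lparr>onObj = (\<lambda>n. onObj G n \<circ> onObj F n), onArr = (\<lambda>n. onArr G n \<circ> onArr F n)\<rparr>"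

definition morphism_eq ::
  "('o, 'm) cat_operad \<Rightarrow> ('o, 'm, 'o2, 'm2) functor_family \<Rightarrow>
    ('o, 'm, 'o2, 'm2) functor_family \<Rightarrow> bool" where
  "morphism_eq P F G \<longleftrightarrow>
    fam_eq (obj_operad P) (onObj F) (onObj G) \<and> fam_eq (arr_operad P) (onArr F) (onArr G)"

locale transformation =
  F: cat_operad_morphism P Q F + G: cat_operad_morphism P Q G
  for P :: "('o, 'm) cat_operad" and Q :: "('o2, 'm2) cat_operad" and F G +
  fixes \<alpha> :: "nat \<Rightarrow> 'o \<Rightarrow> 'm2"
  assumes naturality:
    "natural (Lev P n) (Lev Q n) (onObj F n) (onArr F n) (onObj G n) (onArr G n) (\<alpha> n)"
  and trans_compose:
    "\<lbrakk>p \<in> Obj (Lev P (length ks)); list_all2 (\<lambda>k q. q \<in> Obj (Lev P k)) ks qs\<rbrakk>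
      \<Longrightarrow> \<alpha> (sum_list ks) (ComposeO P ks p qs) = ComposeA Q ks (\<alpha> (length ks) p) (map2 \<alpha> ks qs)"
  and trans_unit: "\<alpha> 1 (UnitO P) = Id (Lev Q 1) (UnitO Q)"
  and trans_act:
    "\<lbrakk>\<sigma> permutes {..<n}; p \<in> Obj (Lev P n)\<rbrakk> \<Longrightarrow> \<alpha> n (ActO P n \<sigma> p) = ActA Q n \<sigma> (\<alpha> n p)"

definition isomorphic_morphisms ::
  "('o, 'm) cat_operad \<Rightarrow> ('o2, 'm2) cat_operad \<Rightarrow>
    ('o, 'm, 'o2, 'm2) functor_family \<Rightarrow> ('o, 'm, 'o2, 'm2) functor_family \<Rightarrow> bool" where
  "isomorphic_morphisms P Q F G \<longleftrightarrow>
    (\<exists>\<alpha> \<beta>. transformation P Q F G \<alpha> \<and> transformation P Q G F \<beta> \<and>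
      (\<forall>n. \<forall>p\<in>Obj (Lev P n).
        Cmp (Lev Q n) (\<beta> n p) (\<alpha> n p) = Id (Lev Q n) (onObj F n p) \<and>
        Cmp (Lev Q n) (\<alpha> n p) (\<beta> n p) = Id (Lev Q n) (onObj G n p)))"

definition cat_operad_equivalent :: "('o, 'm) cat_operad \<Rightarrow> ('o2, 'm2) cat_operad \<Rightarrow> bool" where
  "cat_operad_equivalent P Q \<longleftrightarrow>
    (\<exists>F G. cat_operad_morphism P Q F \<and> cat_operad_morphism Q P G \<and>
      isomorphic_morphisms P P (comp_morphism G F) id_morphism \<and>
      isomorphic_morphisms Q Q (comp_morphism F G) id_morphism)"


section \<open>Categorification\<close>

definition disc_cat :: "'a set \<Rightarrow> ('a, 'a) cat" where
  "disc_cat X =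
    \<lparr>Obj = X, Arr = X, Dom = (\<lambda>x. x), Cod = (\<lambda>x. x), Id = (\<lambda>x. x), Cmp = (\<lambda>g f. f)\<rparr>"

definition disc :: "'a operad \<Rightarrow> ('a, 'a) cat_operad" where
  "disc P =
    \<lparr>Lev = (\<lambda>n. disc_cat (Ops P n)), ComposeO = Compose P, ComposeA = Compose P,
     UnitO = Unit P, ActO = Act P, ActA = Act P\<rparr>"

definition disc_morphism :: "(nat \<Rightarrow> 'a \<Rightarrow> 'b) \<Rightarrow> ('a, 'a, 'b, 'b) functor_family" where
  "disc_morphism f = \<lparr>onObj = f, onArr = f\<rparr>"

definition lev_bij_on_objects ::
  "('o, 'm) cat_operad \<Rightarrow> ('o2, 'm2) cat_operad \<Rightarrow> ('o, 'm, 'o2, 'm2) functor_family \<Rightarrow> bool" where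
  "lev_bij_on_objects P Q F \<longleftrightarrow> (\<forall>n. bij_betw (onObj F n) (Obj (Lev P n)) (Obj (Lev Q n)))"

definition lev_full_faithful ::
  "('o, 'm) cat_operad \<Rightarrow> ('o2, 'm2) cat_operad \<Rightarrow> ('o, 'm, 'o2, 'm2) functor_family \<Rightarrow> bool" where
  "lev_full_faithful P Q F \<longleftrightarrow>
    (\<forall>n. full_faithful (Lev P n) (Lev Q n) (onObj F n) (onArr F n))"

text \<open>
  The categorification is determined up to isomorphism only, so it is rendered as a predicate
  on \<open>Q\<close>; a concrete categorification exists by \<open>is_categorification_exists\<close>, and the counit is a
  signature by \<open>signature_counit\<close>.
\<close>

definition is_categorification ::
  "'p operad \<Rightarrow> (nat \<Rightarrow> 's set) \<Rightarrow> (nat \<Rightarrow> 's opterm set \<Rightarrow> 'p) \<Rightarrow> ('o, 'm) cat_operad \<Rightarrow> bool" where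
  "is_categorification P \<Phi> \<phi> Q \<longleftrightarrow>
    (\<exists>b f. cat_operad_morphism (disc (free_operad \<Phi>)) Q b \<and>
      lev_bij_on_objects (disc (free_operad \<Phi>)) Q b \<and>
      cat_operad_morphism Q (disc P) f \<and>
      lev_full_faithful Q (disc P) f \<and>
      morphism_eq (disc (free_operad \<Phi>)) (comp_morphism f b) (disc_morphism \<phi>))"

definition is_unbiased_categorification :: "'p operad \<Rightarrow> ('o, 'm) cat_operad \<Rightarrow> bool" where
  "is_unbiased_categorification P W \<longleftrightarrow> is_categorification P (Ops P) (counit P) W"

section \<open>Facts about the definitions\<close>

subsection \<open>Block permutations\<close>

lemma block_start_0 [simp]: "block_start ks 0 = 0"
  by (simp add: block_start_def)

lemma block_start_Cons_Suc [simp]: "block_start (k # ks) (Suc i) = k + block_start ks i"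
  by (simp add: block_start_def)

lemma block_start_bound: "\<lbrakk>i < length ks; j < ks ! i\<rbrakk> \<Longrightarrow> block_start ks i + j < sum_list ks"
proof (induction ks arbitrary: i)
  case (Cons k ks)
  then show ?case by (cases i) auto
qed simp

lemma block_start_cover:
  "p < sum_list ks \<Longrightarrow> \<exists>i j. i < length ks \<and> j < ks ! i \<and> p = block_start ks i + j"
proof (induction ks arbitrary: p)
  case (Cons k ks)
  show ?case
  proof (cases "p < k")
    case True
    then show ?thesis by (intro exI[of _ 0] exI[of _ p]) auto
  next
    case False
    then obtain i j where "i < length ks" "j < ks ! i" "p - k = block_start ks i + j"
      using Cons by (metis add_diff_inverse_nat nat_add_left_cancel_less sum_list.Cons)
    then show ?thesis using False by (intro exI[of _ "Suc i"] exI[of _ j]) auto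
  qed
qed simp

lemma nth_concat_block:
  "\<lbrakk>map length xss = ks; i < length ks; j < ks ! i\<rbrakk> \<Longrightarrow> concat xss ! (block_start ks i + j) = xss ! i ! j"
proof (induction xss arbitrary: ks i)
  case (Cons xs xss)
  then show ?case by (cases i) (auto simp: nth_append)
qed simp

lemma permutes_of_list:
  assumes "length L = n" "set L \<supseteq> {..<n}"
  shows "(\<lambda>p. if p < n then L ! p else p) permutes {..<n}"
proof -
  have c: "card (set L) \<le> n" using assms(1) card_length by blast
  have s: "set L = {..<n}" using assms(2) c
    by (metis List.finite_set card_lessThan card_seteq)
  then have "distinct L" using assms(1) by (simp add: card_distinct)
  then have "bij_betw ((!) L) {..<n} {..<n}"
    using s assms(1) by (metis bij_betw_nth)
  then have "bij_betw (\<lambda>p. if p < n then L ! p else p) {..<n} {..<n}"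
    by (rule bij_betw_cong[THEN iffD1, rotated]) simp
  then show ?thesis by (rule bij_imp_permutes) simp
qed

lemma sum_list_permute: "\<sigma> permutes {..<length ks} \<Longrightarrow> sum_list (permute_list \<sigma> ks) = sum_list (ks :: nat list)"
  by (metis mset_permute_list sum_mset_sum_list)

lemma permute_nth_lt: "\<lbrakk>\<sigma> permutes {..<n}; i < n\<rbrakk> \<Longrightarrow> \<sigma> i < n"
  by (metis lessThan_iff permutes_in_image)

theorem block_perm_apply:
  assumes \<sigma>: "\<sigma> permutes {..<length ks}" and i: "i < length ks" and j: "j < ks ! \<sigma> i"
  shows "block_perm ks \<sigma> (block_start (permute_list \<sigma> ks) i + j) = block_start ks (\<sigma> i) + j"
proof -
  have nth: "permute_list \<sigma> ks ! i = ks ! \<sigma> i"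
    using permute_list_nth[OF \<sigma> i] .
  have "block_start (permute_list \<sigma> ks) i + j < sum_list ks"
    using block_start_bound[of i "permute_list \<sigma> ks" j] i j nth sum_list_permute[OF \<sigma>] by simp
  moreover have "map length (map (\<lambda>i. map (\<lambda>j. block_start ks (\<sigma> i) + j) [0..<ks ! \<sigma> i]) [0..<length ks])
      = permute_list \<sigma> ks"
    by (simp add: permute_list_def)
  from nth_concat_block[OF this, of i j]
  have "concat (map (\<lambda>i. map (\<lambda>j. block_start ks (\<sigma> i) + j) [0..<ks ! \<sigma> i]) [0..<length ks]) !
      (block_start (permute_list \<sigma> ks) i + j) = block_start ks (\<sigma> i) + j"
    using i j nth by simp
  ultimately show ?thesis by (simp add: block_perm_def)
qed

lemma block_perm_permutes:
  assumes \<sigma>: "\<sigma> permutes {..<length ks}"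
  shows "block_perm ks \<sigma> permutes {..<sum_list ks}"
proof -
  let ?L = "concat (map (\<lambda>i. map (\<lambda>j. block_start ks (\<sigma> i) + j) [0..<ks ! \<sigma> i]) [0..<length ks])"
  have "length ?L = sum_list (permute_list \<sigma> ks)"
    by (simp add: length_concat permute_list_def comp_def)
  then have len: "length ?L = sum_list ks" using sum_list_permute[OF \<sigma>] by simp
  have "p \<in> set ?L" if p: "p < sum_list ks" for p
  proof -
    obtain i j where ij: "i < length ks" "j < ks ! i" "p = block_start ks i + j"
      using block_start_cover[OF p] by blast
    obtain i' where i': "i' < length ks" "\<sigma> i' = i"
      using permutes_image[OF \<sigma>] ij(1) by (metis imageE lessThan_iff)
    then show ?thesis using ij by (auto intro!: bexI[of _ i'])
  qed
  then have "set ?L \<supseteq> {..<sum_list ks}" by auto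
  from permutes_of_list[OF len this] show ?thesis
    by (simp only: block_perm_def[abs_def])
qed

theorem block_sum_apply:
  assumes i: "i < length ks" and j: "j < ks ! i"
  shows "block_sum ks \<sigma>s (block_start ks i + j) = block_start ks i + (\<sigma>s ! i) j"
proof -
  have "block_start ks i + j < sum_list ks" using block_start_bound i j .
  moreover have "map length (map (\<lambda>i. map (\<lambda>j. block_start ks i + (\<sigma>s ! i) j) [0..<ks ! i]) [0..<length ks]) = ks"
    by (simp add: comp_def map_nth)
  from nth_concat_block[OF this i j]
  have "concat (map (\<lambda>i. map (\<lambda>j. block_start ks i + (\<sigma>s ! i) j) [0..<ks ! i]) [0..<length ks]) !
      (block_start ks i + j) = block_start ks i + (\<sigma>s ! i) j"
    using i j by simp
  ultimately show ?thesis by (simp add: block_sum_def)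
qed

lemma block_sum_permutes:
  assumes \<sigma>s: "list_all2 (\<lambda>k \<sigma>. \<sigma> permutes {..<k}) ks \<sigma>s"
  shows "block_sum ks \<sigma>s permutes {..<sum_list ks}"
proof -
  let ?L = "concat (map (\<lambda>i. map (\<lambda>j. block_start ks i + (\<sigma>s ! i) j) [0..<ks ! i]) [0..<length ks])"
  have len: "length ?L = sum_list ks"
    by (simp add: length_concat comp_def map_nth)
  have "p \<in> set ?L" if p: "p < sum_list ks" for p
  proof -
    obtain i j where ij: "i < length ks" "j < ks ! i" "p = block_start ks i + j"
      using block_start_cover[OF p] by blast
    have "\<sigma>s ! i permutes {..<ks ! i}" using \<sigma>s ij(1) by (simp add: list_all2_conv_all_nth)
    then obtain j' where "j' < ks ! i" "(\<sigma>s ! i) j' = j"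
      using permutes_image ij(2) by (metis imageE lessThan_iff)
    then show ?thesis using ij by (auto intro!: bexI[of _ i])
  qed
  then have "set ?L \<supseteq> {..<sum_list ks}" by auto
  from permutes_of_list[OF len this] show ?thesis
    by (simp only: block_sum_def[abs_def])
qed

lemma list_all2_permute:
  assumes "\<sigma> permutes {..<length ks}" "list_all2 R ks xs"
  shows "list_all2 R (permute_list \<sigma> ks) (permute_list \<sigma> xs)"
  using assms by (auto simp: list_all2_conv_all_nth permute_list_def permute_nth_lt)

subsection \<open>Freeness\<close>

lemma list_all2_map_upt:
  "length xs = length ks \<Longrightarrow>
    list_all2 R ks (map f [0..<length ks]) \<longleftrightarrow> (\<forall>i<length ks. R (ks ! i) (f i))"
  by (simp add: list_all2_conv_all_nth)

lemma wt_compose_nth: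
  "\<lbrakk>wt \<Phi> (length ks) t; length ts = length ks; \<And>i. i < length ks \<Longrightarrow> wt \<Phi> (ks ! i) (ts ! i)\<rbrakk>
    \<Longrightarrow> wt \<Phi> (sum_list ks) (TCompose ks t ts)"
  by (intro wt_compose) (auto simp: list_all2_conv_all_nth)

lemma sum_list_concat_lengths: "sum_list (map length lss) = length (concat lss)"
  by (simp add: length_concat)

lemma teq_wt: "teq \<Phi> n t u \<Longrightarrow> wt \<Phi> n t \<and> wt \<Phi> n u"
proof (induction rule: teq.induct)
  case (teq_compose ks t u ts us)
  then show ?case by (auto intro!: wt_compose_nth)
next
  case (teq_act_id n t)
  then show ?case using wt_act[OF permutes_id] by auto
next
  case (teq_act_comp \<sigma> n \<tau> t)
  then show ?case by (auto intro!: wt.intros permutes_compose)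
next
  case (teq_assoc lss t us vss)
  have l: "length us = length lss" "length vss = length lss"
    using teq_assoc by (auto dest: list_all2_lengthD)
  have "wt \<Phi> (sum_list (map length lss)) (TCompose (map length lss) t us)"
    using teq_assoc by (intro wt_compose_nth) (auto simp: list_all2_conv_all_nth)
  moreover have "list_all2 (wt \<Phi>) (concat lss) (concat vss)"
    using teq_assoc(3) by (rule concat_transfer[THEN rel_funD])
  ultimately have 1: "wt \<Phi> (sum_list (concat lss))
      (TCompose (concat lss) (TCompose (map length lss) t us) (concat vss))"
    by (intro wt_compose) (simp_all add: sum_list_concat_lengths)
  have "wt \<Phi> (sum_list (map sum_list lss)) (TCompose (map sum_list lss) t
      (map (\<lambda>i. TCompose (lss ! i) (us ! i) (vss ! i)) [0..<length lss]))"
    using teq_assoc by (intro wt_compose_nth) (auto simp: list_all2_conv_all_nth intro!: wt_compose_nth)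
  moreover have "sum_list (map sum_list lss) = sum_list (concat lss)"
    by (induction lss) auto
  ultimately show ?case using 1 by simp
next
  case (teq_unit_left n t)
  then have "wt \<Phi> (sum_list [n]) (TCompose [n] TUnit [t])"
    using wt_unit by (intro wt_compose) auto
  then show ?case using teq_unit_left by simp
next
  case (teq_unit_right n t)
  then have "wt \<Phi> (sum_list (replicate n 1)) (TCompose (replicate n 1) t (replicate n TUnit))"
    using wt_unit[of \<Phi>] by (intro wt_compose_nth) auto
  then show ?case using teq_unit_right by (simp add: sum_list_replicate)
next
  case (teq_equivariant_perm \<sigma> ks t us)
  have "wt \<Phi> (sum_list (permute_list \<sigma> ks)) (TCompose (permute_list \<sigma> ks) t (permute_list \<sigma> us))"
    using teq_equivariant_perm by (intro wt_compose list_all2_permute) auto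
  then show ?case using teq_equivariant_perm
    by (auto intro!: wt.intros block_perm_permutes simp: sum_list_permute)
next
  case (teq_equivariant_sum ks t us \<sigma>s)
  then show ?case
    by (auto intro!: wt_act wt_compose block_sum_permutes simp: list_all2_conv_all_nth)
qed (auto intro: wt.intros)

lemma equiv_teq_rel: "equiv {t. wt \<Phi> n t} (teq_rel \<Phi> n)"
  by (rule equivI) (auto simp: teq_rel_def refl_on_def sym_def trans_def
      intro: teq.intros dest: teq_wt)

definition repr :: "(nat \<Rightarrow> 's set) \<Rightarrow> nat \<Rightarrow> 's opterm set \<Rightarrow> 's opterm \<Rightarrow> bool" where
  "repr \<Phi> n X t \<longleftrightarrow> wt \<Phi> n t \<and> X = tclass \<Phi> n t"

lemma repr_eq_iff: "\<lbrakk>repr \<Phi> n X t; repr \<Phi> n Y u\<rbrakk> \<Longrightarrow> X = Y \<longleftrightarrow> teq \<Phi> n t u"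
  using equiv_class_eq_iff[OF equiv_teq_rel, of t u \<Phi> n]
  by (auto simp: repr_def tclass_def teq_rel_def)

lemma repr_teq: "\<lbrakk>repr \<Phi> n X t; teq \<Phi> n t u\<rbrakk> \<Longrightarrow> repr \<Phi> n X u"
  using equiv_class_eq_iff[OF equiv_teq_rel, of t u \<Phi> n]
  by (auto simp: repr_def tclass_def teq_rel_def)

lemma repr_tclass: "wt \<Phi> n t \<Longrightarrow> repr \<Phi> n (tclass \<Phi> n t) t"
  by (simp add: repr_def)

lemma repr_trep_teq:
  assumes "repr \<Phi> n X t"
  shows "teq \<Phi> n t (trep X)"
proof -
  have "t \<in> X" using assms by (auto simp: repr_def tclass_def teq_rel_def intro: teq_refl)
  then have "trep X \<in> X" unfolding trep_def by (rule someI)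
  then show ?thesis using assms by (auto simp: repr_def tclass_def teq_rel_def)
qed

lemma repr_trep: "repr \<Phi> n X t \<Longrightarrow> repr \<Phi> n X (trep X)"
  using repr_teq repr_trep_teq by blast

lemma Ops_free_iff: "X \<in> Ops (free_operad \<Phi>) n \<longleftrightarrow> (\<exists>t. repr \<Phi> n X t)"
  by (auto simp: free_operad_def quotient_def repr_def tclass_def)

lemma free_trep: "X \<in> Ops (free_operad \<Phi>) n \<Longrightarrow> repr \<Phi> n X (trep X)"
  using repr_trep by (auto simp: Ops_free_iff)

lemma repr_Unit: "repr \<Phi> 1 (Unit (free_operad \<Phi>)) TUnit"
  unfolding free_operad_def by (simp only: operad.simps) (rule repr_tclass[OF wt_unit])

lemma repr_Act:
  assumes "\<sigma> permutes {..<n}" "repr \<Phi> n X t"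
  shows "repr \<Phi> n (Act (free_operad \<Phi>) n \<sigma> X) (TAct n \<sigma> t)"
proof -
  have "teq \<Phi> n (TAct n \<sigma> (trep X)) (TAct n \<sigma> t)"
    using assms by (intro teq_act teq_sym[OF repr_trep_teq])
  moreover have "repr \<Phi> n (Act (free_operad \<Phi>) n \<sigma> X) (TAct n \<sigma> (trep X))"
    using calculation teq_wt by (auto simp: free_operad_def intro!: repr_tclass)
  ultimately show ?thesis using repr_teq by blast
qed

lemma repr_Compose:
  assumes "repr \<Phi> (length ks) X t" "length Ys = length ks" "length ts = length ks"
    and "\<And>i. i < length ks \<Longrightarrow> repr \<Phi> (ks ! i) (Ys ! i) (ts ! i)"
  shows "repr \<Phi> (sum_list ks) (Compose (free_operad \<Phi>) ks X Ys) (TCompose ks t ts)"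
proof -
  have "teq \<Phi> (sum_list ks) (TCompose ks (trep X) (map trep Ys)) (TCompose ks t ts)"
    using assms by (intro teq_compose) (auto intro: teq_sym[OF repr_trep_teq])
  moreover have "repr \<Phi> (sum_list ks) (Compose (free_operad \<Phi>) ks X Ys)
      (TCompose ks (trep X) (map trep Ys))"
    using calculation teq_wt by (auto simp: free_operad_def intro!: repr_tclass)
  ultimately show ?thesis using repr_teq by blast
qed

lemma sym_operad_free: "sym_operad (free_operad \<Phi>)"
proof
  let ?F = "free_operad \<Phi>"
  note r = free_trep[of _ \<Phi>]
  note la = list_all2_conv_all_nth
  have wt_r: "wt \<Phi> n (trep X)" if "X \<in> Ops ?F n" for X n
    using r[OF that] by (simp add: repr_def)
  fix f ks gs
  assume f: "f \<in> Ops ?F (length ks)" and gs: "list_all2 (\<lambda>k g. g \<in> Ops ?F k) ks gs"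
  note lg = list_all2_lengthD[OF gs]
  have rc: "repr \<Phi> (sum_list ks) (Compose ?F ks f gs) (TCompose ks (trep f) (map trep gs))"
    using f gs lg by (intro repr_Compose) (auto simp: la intro: r)
  then show "Compose ?F ks f gs \<in> Ops ?F (sum_list ks)" by (auto simp: Ops_free_iff)
  {
    fix \<sigma> assume s: "\<sigma> permutes {..<length ks}"
    have s': "\<sigma> permutes {..<length gs}" using s lg by simp
    have 1: "repr \<Phi> (sum_list ks) (Compose ?F ks (Act ?F (length ks) \<sigma> f) gs)
        (TCompose ks (TAct (length ks) \<sigma> (trep f)) (map trep gs))"
      using f gs lg s by (intro repr_Compose repr_Act) (auto simp: la intro: r)
    have "list_all2 (\<lambda>k g. g \<in> Ops ?F k) (permute_list \<sigma> ks) (permute_list \<sigma> gs)"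
      using list_all2_permute[OF s gs] .
    then have "repr \<Phi> (sum_list (permute_list \<sigma> ks))
        (Compose ?F (permute_list \<sigma> ks) f (permute_list \<sigma> gs))
        (TCompose (permute_list \<sigma> ks) (trep f) (map trep (permute_list \<sigma> gs)))"
      using f by (intro repr_Compose) (auto simp: la intro: r)
    then have 2: "repr \<Phi> (sum_list ks)
        (Act ?F (sum_list ks) (block_perm ks \<sigma>) (Compose ?F (permute_list \<sigma> ks) f (permute_list \<sigma> gs)))
        (TAct (sum_list ks) (block_perm ks \<sigma>)
          (TCompose (permute_list \<sigma> ks) (trep f) (permute_list \<sigma> (map trep gs))))"
      using s by (intro repr_Act block_perm_permutes) (auto simp: sum_list_permute permute_list_map[OF s'])
    have "list_all2 (wt \<Phi>) ks (map trep gs)" using gs by (auto simp: la intro: wt_r)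
    then show "Compose ?F ks (Act ?F (length ks) \<sigma> f) gs =
        Act ?F (sum_list ks) (block_perm ks \<sigma>) (Compose ?F (permute_list \<sigma> ks) f (permute_list \<sigma> gs))"
      using repr_eq_iff[OF 1 2] teq_equivariant_perm[OF s] wt_r f by blast
  }
  {
    fix \<sigma>s assume ss: "list_all2 (\<lambda>k \<sigma>. \<sigma> permutes {..<k}) ks \<sigma>s"
    have 1: "repr \<Phi> (sum_list ks)
        (Compose ?F ks f (map (\<lambda>i. Act ?F (ks ! i) (\<sigma>s ! i) (gs ! i)) [0..<length ks]))
        (TCompose ks (trep f) (map (\<lambda>i. TAct (ks ! i) (\<sigma>s ! i) (map trep gs ! i)) [0..<length ks]))"
      using f gs lg ss by (intro repr_Compose) (auto simp: la intro!: r repr_Act)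
    have 2: "repr \<Phi> (sum_list ks)
        (Act ?F (sum_list ks) (block_sum ks \<sigma>s) (Compose ?F ks f gs))
        (TAct (sum_list ks) (block_sum ks \<sigma>s) (TCompose ks (trep f) (map trep gs)))"
      using ss by (intro repr_Act block_sum_permutes rc)
    have "list_all2 (wt \<Phi>) ks (map trep gs)" using gs by (auto simp: la intro: wt_r)
    then show "Compose ?F ks f (map (\<lambda>i. Act ?F (ks ! i) (\<sigma>s ! i) (gs ! i)) [0..<length ks]) =
        Act ?F (sum_list ks) (block_sum ks \<sigma>s) (Compose ?F ks f gs)"
      using repr_eq_iff[OF 1 2] teq_equivariant_sum[OF wt_r[OF f] _ ss] by blast
  }
next
  show "Unit (free_operad \<Phi>) \<in> Ops (free_operad \<Phi>) 1"
    using repr_Unit Ops_free_iff by blast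
next
  let ?F = "free_operad \<Phi>"
  fix \<sigma> n f assume "\<sigma> permutes {..<n}" and f: "f \<in> Ops ?F n"
  then show "Act ?F n \<sigma> f \<in> Ops ?F n"
    using repr_Act free_trep Ops_free_iff by blast
next
  let ?F = "free_operad \<Phi>"
  fix n f assume f: "f \<in> Ops ?F n"
  note rf = free_trep[OF f]
  have w: "wt \<Phi> n (trep f)" using rf by (simp add: repr_def)
  show "Act ?F n id f = f"
    using repr_eq_iff[OF repr_Act[OF permutes_id rf] rf] teq_act_id[OF w] by blast
  have "repr \<Phi> (sum_list [n]) (Compose ?F [n] (Unit ?F) [f]) (TCompose [n] TUnit [trep f])"
    using repr_Unit rf by (intro repr_Compose) auto
  then have 1: "repr \<Phi> n (Compose ?F [n] (Unit ?F) [f]) (TCompose [n] TUnit [trep f])" by simp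
  show "Compose ?F [n] (Unit ?F) [f] = f"
    using repr_eq_iff[OF 1 rf] teq_unit_left[OF w] by blast
  have "repr \<Phi> (sum_list (replicate n 1)) (Compose ?F (replicate n 1) f (replicate n (Unit ?F)))
      (TCompose (replicate n 1) (trep f) (replicate n TUnit))"
    using repr_Unit[of \<Phi>] rf by (intro repr_Compose) auto
  then have 2: "repr \<Phi> n (Compose ?F (replicate n 1) f (replicate n (Unit ?F)))
      (TCompose (replicate n 1) (trep f) (replicate n TUnit))" by (simp add: sum_list_replicate)
  show "Compose ?F (replicate n 1) f (replicate n (Unit ?F)) = f"
    using repr_eq_iff[OF 2 rf] teq_unit_right[OF w] by blast
  fix \<sigma> \<tau> assume s: "\<sigma> permutes {..<n}" and t: "\<tau> permutes {..<n}"
  show "Act ?F n (\<sigma> \<circ> \<tau>) f = Act ?F n \<sigma> (Act ?F n \<tau> f)"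
    using repr_eq_iff[OF repr_Act[OF permutes_compose[OF t s] rf] repr_Act[OF s repr_Act[OF t rf]]]
      teq_act_comp[OF s t w] by blast
next
  let ?F = "free_operad \<Phi>"
  note r = free_trep[of _ \<Phi>]
  note la = list_all2_conv_all_nth
  have w: "wt \<Phi> n (trep X)" if "X \<in> Ops ?F n" for X n
    using r[OF that] by (simp add: repr_def)
  fix f lss gs hss
  assume f: "f \<in> Ops ?F (length lss)"
    and gs: "list_all2 (\<lambda>ls g. g \<in> Ops ?F (length ls)) lss gs"
    and hss: "list_all2 (list_all2 (\<lambda>l h. h \<in> Ops ?F l)) lss hss"
  note lg = list_all2_lengthD[OF gs] and lh = list_all2_lengthD[OF hss]
  have cc: "list_all2 (\<lambda>l h. h \<in> Ops ?F l) (concat lss) (concat hss)"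
    using hss by (rule concat_transfer[THEN rel_funD])
  have "repr \<Phi> (sum_list (map length lss)) (Compose ?F (map length lss) f gs)
      (TCompose (map length lss) (trep f) (map trep gs))"
    using f gs lg by (intro repr_Compose) (auto simp: la intro: r)
  then have 1: "repr \<Phi> (sum_list (concat lss))
      (Compose ?F (concat lss) (Compose ?F (map length lss) f gs) (concat hss))
      (TCompose (concat lss) (TCompose (map length lss) (trep f) (map trep gs))
        (concat (map (map trep) hss)))"
    using cc by (intro repr_Compose)
      (auto simp: la sum_list_concat_lengths map_concat[symmetric] intro: r)
  have "repr \<Phi> (sum_list (map sum_list lss))
      (Compose ?F (map sum_list lss) f (map (\<lambda>i. Compose ?F (lss ! i) (gs ! i) (hss ! i)) [0..<length lss]))
      (TCompose (map sum_list lss) (trep f)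
        (map (\<lambda>i. TCompose (lss ! i) (map trep gs ! i) (map (map trep) hss ! i)) [0..<length lss]))"
    using f gs hss lg lh by (intro repr_Compose) (auto simp: la intro!: r repr_Compose)
  moreover have "sum_list (map sum_list lss) = sum_list (concat lss)"
    by (induction lss) auto
  ultimately have 2: "repr \<Phi> (sum_list (concat lss))
      (Compose ?F (map sum_list lss) f (map (\<lambda>i. Compose ?F (lss ! i) (gs ! i) (hss ! i)) [0..<length lss]))
      (TCompose (map sum_list lss) (trep f)
        (map (\<lambda>i. TCompose (lss ! i) (map trep gs ! i) (map (map trep) hss ! i)) [0..<length lss]))"
    by simp
  have "teq \<Phi> (sum_list (concat lss))
      (TCompose (concat lss) (TCompose (map length lss) (trep f) (map trep gs))
        (concat (map (map trep) hss)))
      (TCompose (map sum_list lss) (trep f)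
        (map (\<lambda>i. TCompose (lss ! i) (map trep gs ! i) (map (map trep) hss ! i)) [0..<length lss]))"
    using f gs hss by (intro teq_assoc) (auto simp: la intro!: w)
  then show "Compose ?F (concat lss) (Compose ?F (map length lss) f gs) (concat hss) =
      Compose ?F (map sum_list lss) f (map (\<lambda>i. Compose ?F (lss ! i) (gs ! i) (hss ! i)) [0..<length lss])"
    using repr_eq_iff[OF 1 2] by blast
qed

context sym_operad
begin

lemma eval_closed:
  assumes "wt \<Phi> n t" and h: "\<And>n s. s \<in> \<Phi> n \<Longrightarrow> h n s \<in> Ops P n"
  shows "eval P h t \<in> Ops P n"
  using assms(1)
proof (induction rule: wt.induct)
  case (wt_compose ks t ts)
  then show ?case by (auto intro!: compose_closed simp: list_all2_conv_all_nth)
qed (use h unit_closed act_closed in auto)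

lemma eval_teq:
  assumes "teq \<Phi> n t u" and h: "\<And>n s. s \<in> \<Phi> n \<Longrightarrow> h n s \<in> Ops P n"
  shows "eval P h t = eval P h u"
  using assms(1)
proof (induction rule: teq.induct)
  case (teq_compose ks t u ts us)
  then have "map (eval P h) ts = map (eval P h) us" by (intro nth_equalityI) auto
  then show ?case using teq_compose by simp
next
  case (teq_assoc lss t us vss)
  note e = eval_closed[where h = h and \<Phi> = \<Phi>, OF _ h]
  have l: "length us = length lss" "length vss = length lss"
    using teq_assoc by (auto dest: list_all2_lengthD)
  have "Compose P (concat lss) (Compose P (map length lss) (eval P h t) (map (eval P h) us))
      (concat (map (map (eval P h)) vss)) =
    Compose P (map sum_list lss) (eval P h t)
      (map (\<lambda>i. Compose P (lss ! i) (map (eval P h) us ! i) (map (map (eval P h)) vss ! i)) [0..<length lss])"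
    using teq_assoc by (intro assoc) (auto simp: list_all2_conv_all_nth intro: e)
  also have "map (\<lambda>i. Compose P (lss ! i) (map (eval P h) us ! i) (map (map (eval P h)) vss ! i)) [0..<length lss] =
     map (\<lambda>i. Compose P (lss ! i) (eval P h (us ! i)) (map (eval P h) (vss ! i))) [0..<length lss]"
    using l by simp
  finally show ?case by (simp add: map_concat comp_def)
next
  case (teq_equivariant_perm \<sigma> ks t us)
  note e = eval_closed[where h = h and \<Phi> = \<Phi>, OF _ h]
  have "\<sigma> permutes {..<length us}"
    using teq_equivariant_perm by (metis list_all2_lengthD)
  note pm = permute_list_map[OF this, of "eval P h"]
  show ?case unfolding eval.simps pm[symmetric]
    using teq_equivariant_perm by (intro equivariant_perm) (auto simp: list_all2_conv_all_nth intro: e)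
next
  case (teq_equivariant_sum ks t us \<sigma>s)
  note e = eval_closed[where h = h and \<Phi> = \<Phi>, OF _ h]
  have l: "length us = length ks"
    using teq_equivariant_sum by (auto dest: list_all2_lengthD)
  have "Compose P ks (eval P h t)
      (map (\<lambda>i. Act P (ks ! i) (\<sigma>s ! i) (map (eval P h) us ! i)) [0..<length ks]) =
    Act P (sum_list ks) (block_sum ks \<sigma>s) (Compose P ks (eval P h t) (map (eval P h) us))"
    using teq_equivariant_sum by (intro equivariant_sum) (auto simp: list_all2_conv_all_nth intro: e)
  also have "map (\<lambda>i. Act P (ks ! i) (\<sigma>s ! i) (map (eval P h) us ! i)) [0..<length ks] =
    map (\<lambda>i. Act P (ks ! i) (\<sigma>s ! i) (eval P h (us ! i))) [0..<length ks]"
    using l by simp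
  finally show ?case by (simp add: comp_def)
next
  case (teq_act_id n t)
  show ?case unfolding eval.simps by (rule act_id[OF eval_closed[OF teq_act_id h]])
next
  case (teq_act_comp \<sigma> n \<tau> t)
  show ?case unfolding eval.simps
    by (rule act_comp[OF teq_act_comp(1,2) eval_closed[OF teq_act_comp(3) h]])
next
  case (teq_unit_left n t)
  show ?case using unit_left[OF eval_closed[OF teq_unit_left h]] by simp
next
  case (teq_unit_right n t)
  show ?case using unit_right[OF eval_closed[OF teq_unit_right h]] by (simp add: map_replicate_const)
qed simp_all

lemma free_ext_repr:
  assumes "repr \<Phi> n X t" and h: "\<And>n s. s \<in> \<Phi> n \<Longrightarrow> h n s \<in> Ops P n"
  shows "free_ext P h n X = eval P h t"
  using eval_teq[OF repr_trep_teq[OF assms(1)] h] by (simp add: free_ext_def)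

lemma free_ext_morphism:
  assumes h: "\<And>n s. s \<in> \<Phi> n \<Longrightarrow> h n s \<in> Ops P n"
  shows "operad_morphism (free_operad \<Phi>) P (free_ext P h)"
proof (intro operad_morphism.intro sym_operad_free sym_operad_axioms operad_morphism_axioms.intro)
  let ?F = "free_operad \<Phi>"
  note e = free_ext_repr[where h = h and \<Phi> = \<Phi>, OF _ h]
  show "free_ext P h n x \<in> Ops P n" if "x \<in> Ops ?F n" for x n
    using free_trep[OF that] eval_closed[OF _ h] by (auto simp: free_ext_def repr_def)
  show "free_ext P h 1 (Unit ?F) = Unit P"
    using e[OF repr_Unit] by simp
  show "free_ext P h n (Act ?F n \<sigma> x) = Act P n \<sigma> (free_ext P h n x)"
    if "\<sigma> permutes {..<n}" "x \<in> Ops ?F n" for \<sigma> n x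
    using e[OF repr_Act[OF that(1) free_trep[OF that(2)]]] by (simp add: free_ext_def)
  fix x ks ys assume x: "x \<in> Ops ?F (length ks)" and ys: "list_all2 (\<lambda>k y. y \<in> Ops ?F k) ks ys"
  have "repr \<Phi> (sum_list ks) (Compose ?F ks x ys) (TCompose ks (trep x) (map trep ys))"
    using x ys by (intro repr_Compose) (auto simp: list_all2_conv_all_nth intro: free_trep)
  from e[OF this] have "free_ext P h (sum_list ks) (Compose ?F ks x ys) =
      Compose P ks (free_ext P h (length ks) x) (map (eval P h) (map trep ys))"
    by (simp add: free_ext_def)
  also have "map (eval P h) (map trep ys) = map2 (free_ext P h) ks ys"
    using ys by (intro nth_equalityI) (auto simp: list_all2_conv_all_nth free_ext_def)
  finally show "free_ext P h (sum_list ks) (Compose ?F ks x ys) =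
      Compose P ks (free_ext P h (length ks) x) (map2 (free_ext P h) ks ys)" .
qed

lemma free_ext_gen:
  assumes h: "\<And>n s. s \<in> \<Phi> n \<Longrightarrow> h n s \<in> Ops P n" and "s \<in> \<Phi> n"
  shows "free_ext P h n (free_gen \<Phi> n s) = h n s"
proof -
  have "repr \<Phi> n (free_gen \<Phi> n s) (TGen n s)"
    unfolding free_gen_def using wt_gen[of s \<Phi> n] assms(2) by (simp add: repr_tclass)
  from free_ext_repr[OF this h] show ?thesis by simp
qed

end

lemma free_morphism_unique:
  assumes k: "operad_morphism (free_operad \<Phi>) P k" and k': "operad_morphism (free_operad \<Phi>) P k'"
    and gen: "\<And>n s. s \<in> \<Phi> n \<Longrightarrow> k n (free_gen \<Phi> n s) = k' n (free_gen \<Phi> n s)"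
  shows "fam_eq (free_operad \<Phi>) k k'"
proof -
  let ?F = "free_operad \<Phi>"
  interpret k: operad_morphism ?F P k by (rule k)
  interpret k': operad_morphism ?F P k' by (rule k')
  have *: "k n (tclass \<Phi> n t) = k' n (tclass \<Phi> n t)" if "wt \<Phi> n t" for n t
    using that
  proof (induction rule: wt.induct)
    case (wt_gen s n)
    then show ?case using gen by (simp add: free_gen_def)
  next
    case wt_unit
    have "tclass \<Phi> 1 TUnit = Unit ?F" using repr_Unit[of \<Phi>] unfolding repr_def by blast
    then show ?case using k.pres_unit k'.pres_unit by simp
  next
    case (wt_compose ks t ts)
    let ?Ys = "map2 (tclass \<Phi>) ks ts"
    have l: "length ts = length ks" using wt_compose by (simp add: list_all2_lengthD)
    have c: "tclass \<Phi> (sum_list ks) (TCompose ks t ts) = Compose ?F ks (tclass \<Phi> (length ks) t) ?Ys"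
      using wt_compose l repr_Compose[of \<Phi> ks "tclass \<Phi> (length ks) t" t ?Ys ts]
      by (auto simp: repr_def list_all2_conv_all_nth)
    have o: "tclass \<Phi> (length ks) t \<in> Ops ?F (length ks)" "list_all2 (\<lambda>k y. y \<in> Ops ?F k) ks ?Ys"
      using wt_compose l by (auto simp: list_all2_conv_all_nth Ops_free_iff intro: repr_tclass)
    have m: "map2 k ks ?Ys = map2 k' ks ?Ys"
      using wt_compose l by (intro nth_equalityI) (auto simp: list_all2_conv_all_nth)
    have e: "k (length ks) (tclass \<Phi> (length ks) t) = k' (length ks) (tclass \<Phi> (length ks) t)"
      using wt_compose by blast
    show ?case unfolding c k.pres_compose[OF o] k'.pres_compose[OF o] m e ..
  next
    case (wt_act \<sigma> n t)
    have c: "tclass \<Phi> n (TAct n \<sigma> t) = Act ?F n \<sigma> (tclass \<Phi> n t)"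
      using repr_Act[OF wt_act(1) repr_tclass[OF wt_act(2)]] by (simp add: repr_def)
    have o: "tclass \<Phi> n t \<in> Ops ?F n"
      using wt_act by (auto simp: Ops_free_iff intro: repr_tclass)
    show ?case unfolding c k.pres_act[OF wt_act(1) o] k'.pres_act[OF wt_act(1) o]
      using wt_act by simp
  qed
  then show ?thesis by (auto simp: fam_eq_def Ops_free_iff repr_def)
qed

theorem free_operad_universal:
  assumes "sym_operad P" and h: "\<And>n s. s \<in> \<Phi> n \<Longrightarrow> h n s \<in> Ops P n"
  shows "operad_morphism (free_operad \<Phi>) P (free_ext P h) \<and>
    (\<forall>n. \<forall>s\<in>\<Phi> n. free_ext P h n (free_gen \<Phi> n s) = h n s) \<and>
    (\<forall>k. operad_morphism (free_operad \<Phi>) P k \<and> (\<forall>n. \<forall>s\<in>\<Phi> n. k n (free_gen \<Phi> n s) = h n s)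
      \<longrightarrow> fam_eq (free_operad \<Phi>) k (free_ext P h))"
proof -
  interpret sym_operad P by (rule assms(1))
  show ?thesis
    using free_ext_morphism[where h = h and \<Phi> = \<Phi>, OF h] free_ext_gen[where h = h and \<Phi> = \<Phi>, OF h]
      free_morphism_unique[of \<Phi> P _ "free_ext P h"] by auto
qed

subsection \<open>Regular epimorphisms\<close>

lemma sum_list_map_sum_list: "sum_list (map sum_list lss) = sum_list (concat (lss :: nat list list))"
  by (induction lss) auto

lemma operad_reflect:
  fixes X :: "'x operad" and A :: "'a operad"
  assumes A: "sym_operad A"
    and cc: "\<And>x ks ys. \<lbrakk>x \<in> Ops X (length ks); list_all2 (\<lambda>k y. y \<in> Ops X k) ks ys\<rbrakk>
      \<Longrightarrow> Compose X ks x ys \<in> Ops X (sum_list ks)"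
    and uc: "Unit X \<in> Ops X 1"
    and ac: "\<And>\<sigma> n x. \<lbrakk>\<sigma> permutes {..<n}; x \<in> Ops X n\<rbrakk> \<Longrightarrow> Act X n \<sigma> x \<in> Ops X n"
    and J: "\<And>j. j \<in> J \<Longrightarrow> operad_morphism_axioms X A j"
    and inj: "\<And>n x y. \<lbrakk>x \<in> Ops X n; y \<in> Ops X n; \<And>j. j \<in> J \<Longrightarrow> j n x = j n y\<rbrakk> \<Longrightarrow> x = y"
  shows "sym_operad X"
proof
  interpret A: sym_operad A by (rule A)
  note la = list_all2_conv_all_nth
  note jm = J[unfolded operad_morphism_axioms_def]
  have jo: "j n x \<in> Ops A n" if "j \<in> J" "x \<in> Ops X n" for j n x
    using jm[OF that(1)] that(2) by blast
  have jc: "j (sum_list ks) (Compose X ks x ys) = Compose A ks (j (length ks) x) (map2 j ks ys)"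
    if "j \<in> J" "x \<in> Ops X (length ks)" "list_all2 (\<lambda>k y. y \<in> Ops X k) ks ys" for j ks x ys
    using jm[OF that(1)] that(2,3) by blast
  have ju: "j 1 (Unit X) = Unit A" if "j \<in> J" for j
    using jm[OF that(1)] by blast
  have ja: "j n (Act X n \<sigma> x) = Act A n \<sigma> (j n x)"
    if "j \<in> J" "\<sigma> permutes {..<n}" "x \<in> Ops X n" for j n \<sigma> x
    using jm[OF that(1)] that(2,3) by blast
  {
    fix f ks gs
    assume f: "f \<in> Ops X (length ks)" and gs: "list_all2 (\<lambda>k g. g \<in> Ops X k) ks gs"
    then show c: "Compose X ks f gs \<in> Ops X (sum_list ks)" by (rule cc)
    note lg = list_all2_lengthD[OF gs]
    have jg: "list_all2 (\<lambda>k g. g \<in> Ops A k) ks (map2 j ks gs)" if "j \<in> J" for j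
      using gs that by (auto simp: la intro: jo)
    {
      fix \<sigma> assume s: "\<sigma> permutes {..<length ks}"
      have s': "\<sigma> permutes {..<length gs}" using s lg by simp
      have c1: "Compose X ks (Act X (length ks) \<sigma> f) gs \<in> Ops X (sum_list ks)"
        using s f gs by (intro cc ac)
      have pf: "f \<in> Ops X (length (permute_list \<sigma> ks))" using f by simp
      have pg: "list_all2 (\<lambda>k g. g \<in> Ops X k) (permute_list \<sigma> ks) (permute_list \<sigma> gs)"
        using list_all2_permute[OF s gs] .
      have c2: "Compose X (permute_list \<sigma> ks) f (permute_list \<sigma> gs) \<in> Ops X (sum_list ks)"
        using cc[OF pf pg] sum_list_permute[OF s] by simp
      show "Compose X ks (Act X (length ks) \<sigma> f) gs =
        Act X (sum_list ks) (block_perm ks \<sigma>) (Compose X (permute_list \<sigma> ks) f (permute_list \<sigma> gs))"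
      proof (rule inj[OF c1 ac[OF block_perm_permutes[OF s] c2]])
        fix j assume j: "j \<in> J"
        have z: "map2 j (permute_list \<sigma> ks) (permute_list \<sigma> gs) = permute_list \<sigma> (map2 j ks gs)"
          using lg s by (intro nth_equalityI) (auto simp: permute_list_nth permute_nth_lt)
        show "j (sum_list ks) (Compose X ks (Act X (length ks) \<sigma> f) gs) = j (sum_list ks)
          (Act X (sum_list ks) (block_perm ks \<sigma>) (Compose X (permute_list \<sigma> ks) f (permute_list \<sigma> gs)))"
          using jc[OF j ac[OF s f] gs] ja[OF j s f] ja[OF j block_perm_permutes[OF s] c2]
            jc[OF j pf pg] A.equivariant_perm[OF s jo[OF j f] jg[OF j]]
          by (simp add: sum_list_permute[OF s] z)
      qed
    }
    {
      fix \<sigma>s assume ss: "list_all2 (\<lambda>k \<sigma>. \<sigma> permutes {..<k}) ks \<sigma>s"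
      let ?gs = "map (\<lambda>i. Act X (ks ! i) (\<sigma>s ! i) (gs ! i)) [0..<length ks]"
      have ga: "list_all2 (\<lambda>k g. g \<in> Ops X k) ks ?gs"
        using gs ss by (auto simp: la intro!: ac)
      show "Compose X ks f ?gs = Act X (sum_list ks) (block_sum ks \<sigma>s) (Compose X ks f gs)"
      proof (rule inj[OF cc[OF f ga] ac[OF block_sum_permutes[OF ss] c]])
        fix j assume j: "j \<in> J"
        have z: "map2 j ks ?gs = map (\<lambda>i. Act A (ks ! i) (\<sigma>s ! i) (map2 j ks gs ! i)) [0..<length ks]"
          using lg gs ss by (intro nth_equalityI) (auto simp: la intro!: ja[OF j])
        show "j (sum_list ks) (Compose X ks f ?gs) =
          j (sum_list ks) (Act X (sum_list ks) (block_sum ks \<sigma>s) (Compose X ks f gs))"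
          unfolding jc[OF j f ga] ja[OF j block_sum_permutes[OF ss] c] jc[OF j f gs] z
          by (rule A.equivariant_sum[OF jo[OF j f] jg[OF j] ss])
      qed
    }
  }
  show "Unit X \<in> Ops X 1" by (rule uc)
  {
    fix n f assume f: "f \<in> Ops X n"
    show "Act X n \<sigma> f \<in> Ops X n" if "\<sigma> permutes {..<n}" for \<sigma>
      using that f by (rule ac)
    show "Act X n id f = f"
      by (rule inj[OF ac[OF permutes_id f] f]) (simp only: ja[OF _ permutes_id f] A.act_id[OF jo[OF _ f]])
    have l: "list_all2 (\<lambda>k y. y \<in> Ops X k) [n] [f]" "Unit X \<in> Ops X (length [n])" using f uc by auto
    have cl: "Compose X [n] (Unit X) [f] \<in> Ops X n" using cc[OF l(2,1)] by simp
    show "Compose X [n] (Unit X) [f] = f"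
    proof (rule inj[OF cl f])
      fix j assume j: "j \<in> J"
      show "j n (Compose X [n] (Unit X) [f]) = j n f"
        using jc[OF j l(2,1)] A.unit_left[OF jo[OF j f]] ju[OF j] by simp
    qed
    have r: "list_all2 (\<lambda>k y. y \<in> Ops X k) (replicate n 1) (replicate n (Unit X))"
      "f \<in> Ops X (length (replicate n (1::nat)))" using f uc by (auto simp: la)
    have cr: "Compose X (replicate n 1) f (replicate n (Unit X)) \<in> Ops X n"
      using cc[OF r(2,1)] by (simp add: sum_list_replicate)
    show "Compose X (replicate n 1) f (replicate n (Unit X)) = f"
    proof (rule inj[OF cr f])
      fix j assume j: "j \<in> J"
      show "j n (Compose X (replicate n 1) f (replicate n (Unit X))) = j n f"
        using jc[OF j r(2,1)] A.unit_right[OF jo[OF j f]] ju[OF j]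
        by (simp add: sum_list_replicate zip_replicate)
    qed
    fix \<sigma> \<tau> assume s: "\<sigma> permutes {..<n}" and t: "\<tau> permutes {..<n}"
    note st = permutes_compose[OF t s]
    show "Act X n (\<sigma> \<circ> \<tau>) f = Act X n \<sigma> (Act X n \<tau> f)"
      by (rule inj[OF ac[OF st f] ac[OF s ac[OF t f]]])
        (simp only: ja[OF _ st f] ja[OF _ s ac[OF t f]] ja[OF _ t f] A.act_comp[OF s t jo[OF _ f]])
  }
  fix f lss gs hss
  assume f: "f \<in> Ops X (length lss)"
    and gs: "list_all2 (\<lambda>ls g. g \<in> Ops X (length ls)) lss gs"
    and hss: "list_all2 (list_all2 (\<lambda>l h. h \<in> Ops X l)) lss hss"
  let ?ghs = "map (\<lambda>i. Compose X (lss ! i) (gs ! i) (hss ! i)) [0..<length lss]"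
  note lg = list_all2_lengthD[OF gs] and lh = list_all2_lengthD[OF hss]
  have f1: "f \<in> Ops X (length (map length lss))" "f \<in> Ops X (length (map sum_list lss))"
    using f by auto
  have g1: "list_all2 (\<lambda>k g. g \<in> Ops X k) (map length lss) gs" using gs by (auto simp: la)
  have h1: "list_all2 (\<lambda>k g. g \<in> Ops X k) (concat lss) (concat hss)"
    using hss by (rule concat_transfer[THEN rel_funD])
  have gh: "list_all2 (\<lambda>k g. g \<in> Ops X k) (map sum_list lss) ?ghs"
    using gs hss lg lh by (auto simp: la intro!: cc)
  have c1: "Compose X (map length lss) f gs \<in> Ops X (length (concat lss))"
    using cc[OF f1(1) g1] by (simp add: sum_list_concat_lengths)
  show "Compose X (concat lss) (Compose X (map length lss) f gs) (concat hss) =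
    Compose X (map sum_list lss) f ?ghs"
  proof (rule inj[OF cc[OF c1 h1]])
    show "Compose X (map sum_list lss) f ?ghs \<in> Ops X (sum_list (concat lss))"
      using cc[OF f1(2) gh] by (simp add: sum_list_map_sum_list)
    fix j assume j: "j \<in> J"
    have "j (sum_list (concat lss)) (Compose X (concat lss) (Compose X (map length lss) f gs) (concat hss))
      = Compose A (concat lss) (Compose A (map length lss) (j (length lss) f) (map2 j (map length lss) gs))
          (map2 j (concat lss) (concat hss))"
      using jc[OF j c1 h1] jc[OF j f1(1) g1] by (simp add: sum_list_concat_lengths)
    also have "map2 j (concat lss) (concat hss) = concat (map2 (map2 j) lss hss)"
      using hss by (induction rule: list_all2_induct) (auto simp: list_all2_lengthD)
    also have "Compose A (concat lss) (Compose A (map length lss) (j (length lss) f) (map2 j (map length lss) gs)) \<dots>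
      = Compose A (map sum_list lss) (j (length lss) f) (map (\<lambda>i. Compose A (lss ! i)
        (map2 j (map length lss) gs ! i) (map2 (map2 j) lss hss ! i)) [0..<length lss])"
      using f gs hss by (intro A.assoc) (auto simp: la intro!: jo[OF j])
    also have "map (\<lambda>i. Compose A (lss ! i) (map2 j (map length lss) gs ! i) (map2 (map2 j) lss hss ! i)) [0..<length lss]
      = map2 j (map sum_list lss) ?ghs"
    proof (intro nth_equalityI)
      fix i assume "i < length (map (\<lambda>i. Compose A (lss ! i) (map2 j (map length lss) gs ! i)
        (map2 (map2 j) lss hss ! i)) [0..<length lss])"
      then have i: "i < length lss" by simp
      have "gs ! i \<in> Ops X (length (lss ! i))" "list_all2 (\<lambda>l h. h \<in> Ops X l) (lss ! i) (hss ! i)"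
        using gs hss i by (auto simp: la)
      from jc[OF j this]
      show "map (\<lambda>i. Compose A (lss ! i) (map2 j (map length lss) gs ! i)
          (map2 (map2 j) lss hss ! i)) [0..<length lss] ! i = map2 j (map sum_list lss) ?ghs ! i"
        using i lg lh by simp
    qed simp
    also have "Compose A (map sum_list lss) (j (length lss) f) \<dots> =
      j (sum_list (concat lss)) (Compose X (map sum_list lss) f ?ghs)"
      using jc[OF j f1(2) gh] by (simp add: sum_list_map_sum_list)
    finally show "j (sum_list (concat lss)) (Compose X (concat lss) (Compose X (map length lss) f gs) (concat hss)) =
      j (sum_list (concat lss)) (Compose X (map sum_list lss) f ?ghs)" .
  qed
qed

lemma map2_snd: "length ys = length ks \<Longrightarrow> map2 (\<lambda>n x. x) ks ys = ys"
  by (intro nth_equalityI) auto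

lemma id_operad_morphism: "sym_operad A \<Longrightarrow> operad_morphism A A (\<lambda>n x. x)"
  by (simp add: operad_morphism_def operad_morphism_axioms_def list_all2_lengthD map2_snd)

lemma comp_operad_morphism:
  assumes f: "operad_morphism A B f" and g: "operad_morphism B C g"
  shows "operad_morphism A C (\<lambda>n. g n \<circ> f n)"
proof -
  interpret f: operad_morphism A B f by (rule f)
  interpret g: operad_morphism B C g by (rule g)
  show ?thesis
  proof
    fix x ks ys assume x: "x \<in> Ops A (length ks)" and ys: "list_all2 (\<lambda>k y. y \<in> Ops A k) ks ys"
    have "list_all2 (\<lambda>k y. y \<in> Ops B k) ks (map2 f ks ys)"
      using ys by (auto simp: list_all2_conv_all_nth intro: f.maps)
    from g.pres_compose[OF f.maps[OF x] this]
    have "(g (sum_list ks) \<circ> f (sum_list ks)) (Compose A ks x ys) =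
      Compose C ks ((g (length ks) \<circ> f (length ks)) x) (map2 g ks (map2 f ks ys))"
      using f.pres_compose[OF x ys] by simp
    also have "map2 g ks (map2 f ks ys) = map2 (\<lambda>n. g n \<circ> f n) ks ys"
      by (intro nth_equalityI) auto
    finally show "(g (sum_list ks) \<circ> f (sum_list ks)) (Compose A ks x ys) =
      Compose C ks ((g (length ks) \<circ> f (length ks)) x) (map2 (\<lambda>n. g n \<circ> f n) ks ys)" .
  qed (use f.maps g.maps f.pres_unit g.pres_unit f.pres_act g.pres_act in auto)
qed

definition kernel_pair :: "'a operad \<Rightarrow> (nat \<Rightarrow> 'a \<Rightarrow> 'b) \<Rightarrow> ('a \<times> 'a) operad" where
  "kernel_pair A e =
    \<lparr>Ops = (\<lambda>n. {(x, y). x \<in> Ops A n \<and> y \<in> Ops A n \<and> e n x = e n y}),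
     Compose = (\<lambda>ks p qs. (Compose A ks (fst p) (map fst qs), Compose A ks (snd p) (map snd qs))),
     Unit = (Unit A, Unit A),
     Act = (\<lambda>n \<sigma>. map_prod (Act A n \<sigma>) (Act A n \<sigma>))\<rparr>"

lemma map2_const: "length xs = length ks \<Longrightarrow> map2 (\<lambda>_. f) ks xs = map f xs"
  by (intro nth_equalityI) auto

lemma kernel_pair_operad:
  assumes e: "operad_morphism A B e"
  shows "sym_operad (kernel_pair A e)"
    and "operad_morphism (kernel_pair A e) A (\<lambda>n. fst)"
    and "operad_morphism (kernel_pair A e) A (\<lambda>n. snd)"
proof -
  interpret e: operad_morphism A B e by (rule e)
  let ?K = "kernel_pair A e"
  note la = list_all2_conv_all_nth
  have fst: "operad_morphism_axioms ?K A (\<lambda>n. fst)"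
    by unfold_locales (auto simp: kernel_pair_def map2_const list_all2_lengthD)
  have snd: "operad_morphism_axioms ?K A (\<lambda>n. snd)"
    by unfold_locales (auto simp: kernel_pair_def map2_const list_all2_lengthD)
  show K: "sym_operad ?K"
  proof (rule operad_reflect[OF e.P.sym_operad_axioms, where J = "{\<lambda>n. fst, \<lambda>n. snd}"])
    fix x ks ys assume x: "x \<in> Ops ?K (length ks)" and ys: "list_all2 (\<lambda>k y. y \<in> Ops ?K k) ks ys"
    have 1: "fst x \<in> Ops A (length ks)" "snd x \<in> Ops A (length ks)" "e (length ks) (fst x) = e (length ks) (snd x)"
      using x by (auto simp: kernel_pair_def)
    have 2: "list_all2 (\<lambda>k y. y \<in> Ops A k) ks (map fst ys)" "list_all2 (\<lambda>k y. y \<in> Ops A k) ks (map snd ys)"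
      using ys by (auto simp: la kernel_pair_def case_prod_beta)
    have 3: "map2 e ks (map fst ys) = map2 e ks (map snd ys)"
      using ys by (intro nth_equalityI) (auto simp: la kernel_pair_def case_prod_beta)
    show "Compose ?K ks x ys \<in> Ops ?K (sum_list ks)"
      using e.P.compose_closed[OF 1(1) 2(1)] e.P.compose_closed[OF 1(2) 2(2)]
        e.pres_compose[OF 1(1) 2(1)] e.pres_compose[OF 1(2) 2(2)] 1(3) 3
      by (simp add: kernel_pair_def)
  next
    show "Unit ?K \<in> Ops ?K 1" using e.P.unit_closed by (simp add: kernel_pair_def)
  next
    fix \<sigma> n x assume "\<sigma> permutes {..<n}" "x \<in> Ops ?K n"
    then show "Act ?K n \<sigma> x \<in> Ops ?K n"
      using e.P.act_closed e.pres_act by (auto simp: kernel_pair_def)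
  qed (use fst snd in \<open>auto simp: prod_eq_iff\<close>)
  show "operad_morphism ?K A (\<lambda>n. fst)" "operad_morphism ?K A (\<lambda>n. snd)"
    using K e.P.sym_operad_axioms fst snd by (auto simp: operad_morphism_def)
qed

lemma surjective_coequalizer:
  assumes e: "operad_morphism A B e" and surj: "\<And>n. e n ` Ops A n = Ops B n"
  shows "coequalizer TYPE('z) (kernel_pair A e) A B (\<lambda>n. fst) (\<lambda>n. snd) e"
  unfolding coequalizer_def
proof (intro conjI allI impI)
  interpret e: operad_morphism A B e by (rule e)
  show "operad_morphism A B e" by (rule e)
  show "operad_morphism (kernel_pair A e) A (\<lambda>n. fst)" "operad_morphism (kernel_pair A e) A (\<lambda>n. snd)"
    using kernel_pair_operad[OF e] by auto
  show "fam_eq (kernel_pair A e) (\<lambda>n. e n \<circ> fst) (\<lambda>n. e n \<circ> snd)"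
    by (auto simp: fam_eq_def kernel_pair_def)
  fix Z :: "'z operad" and m
  assume asm: "operad_morphism A Z m \<and> fam_eq (kernel_pair A e) (\<lambda>n. m n \<circ> fst) (\<lambda>n. m n \<circ> snd)"
  then interpret m: operad_morphism A Z m by simp
  define s where "s n y = (SOME x. x \<in> Ops A n \<and> e n x = y)" for n y
  have s: "s n y \<in> Ops A n \<and> e n (s n y) = y" if "y \<in> Ops B n" for n y
  proof -
    have "\<exists>x. x \<in> Ops A n \<and> e n x = y" using that surj[of n] by (metis imageE)
    then show ?thesis unfolding s_def by (rule someI_ex)
  qed
  define k where "k n y = m n (s n y)" for n y
  have mm: "m n x = m n x'" if "x \<in> Ops A n" "x' \<in> Ops A n" "e n x = e n x'" for n x x'
  proof -
    have "(x, x') \<in> Ops (kernel_pair A e) n" using that by (simp add: kernel_pair_def)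
    then have "(m n \<circ> fst) (x, x') = (m n \<circ> snd) (x, x')"
      using asm unfolding fam_eq_def by blast
    then show ?thesis by simp
  qed
  have ke: "k n (e n x) = m n x" if "x \<in> Ops A n" for n x
    unfolding k_def using s[OF e.maps[OF that]] that by (intro mm) auto
  have "operad_morphism B Z k"
  proof (intro operad_morphism.intro operad_morphism_axioms.intro e.Q.sym_operad_axioms m.Q.sym_operad_axioms)
    show "k n y \<in> Ops Z n" if "y \<in> Ops B n" for n y
      using s[OF that] m.maps by (simp add: k_def)
    show "k 1 (Unit B) = Unit Z"
      using ke[OF e.P.unit_closed] e.pres_unit m.pres_unit by simp
    show "k n (Act B n \<sigma> y) = Act Z n \<sigma> (k n y)" if "\<sigma> permutes {..<n}" "y \<in> Ops B n" for n \<sigma> y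
      using ke[OF e.P.act_closed[OF that(1), of "s n y"]] s[OF that(2)] e.pres_act[OF that(1), of "s n y"]
        m.pres_act[OF that(1), of "s n y"] by (simp add: k_def)
    fix y ks zs assume y: "y \<in> Ops B (length ks)" and zs: "list_all2 (\<lambda>k y. y \<in> Ops B k) ks zs"
    let ?zs = "map2 s ks zs"
    have l: "list_all2 (\<lambda>k y. y \<in> Ops A k) ks ?zs" "map2 e ks ?zs = zs"
      using zs s by (auto simp: list_all2_conv_all_nth intro!: nth_equalityI)
    have "map2 m ks ?zs = map2 k ks zs" by (intro nth_equalityI) (auto simp: k_def)
    then show "k (sum_list ks) (Compose B ks y zs) = Compose Z ks (k (length ks) y) (map2 k ks zs)"
      using s[OF y] l ke[OF e.P.compose_closed[OF _ l(1), of "s (length ks) y"]]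
        e.pres_compose[OF _ l(1), of "s (length ks) y"] m.pres_compose[OF _ l(1), of "s (length ks) y"]
      by (simp add: k_def)
  qed
  moreover have "fam_eq A (\<lambda>n. k n \<circ> e n) m" using ke by (simp add: fam_eq_def)
  moreover have "fam_eq B k' k" if "fam_eq A (\<lambda>n. k' n \<circ> e n) m" for k'
    unfolding fam_eq_def
  proof (intro allI ballI)
    fix n y assume "y \<in> Ops B n"
    then obtain x where "x \<in> Ops A n" "y = e n x" using surj[of n] by blast
    then show "k' n y = k n y" using that ke by (simp add: fam_eq_def)
  qed
  ultimately show "\<exists>k. operad_morphism B Z k \<and> fam_eq A (\<lambda>n. k n \<circ> e n) m \<and>
    (\<forall>k'. operad_morphism B Z k' \<and> fam_eq A (\<lambda>n. k' n \<circ> e n) m \<longrightarrow> fam_eq B k' k)" by blast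
qed

lemma coequalizer_surjective:
  fixes B :: "'b operad"
  assumes c: "coequalizer TYPE('b) R A B u v e"
  shows "e n ` Ops A n = Ops B n"
proof
  have e: "operad_morphism A B e" and uv: "fam_eq R (\<lambda>n. e n \<circ> u n) (\<lambda>n. e n \<circ> v n)"
    using c by (auto simp: coequalizer_def)
  have univ: "\<exists>k. operad_morphism B Z k \<and> fam_eq A (\<lambda>n. k n \<circ> e n) m \<and>
      (\<forall>k'. operad_morphism B Z k' \<and> fam_eq A (\<lambda>n. k' n \<circ> e n) m \<longrightarrow> fam_eq B k' k)"
    if "operad_morphism A Z m" "fam_eq R (\<lambda>n. m n \<circ> u n) (\<lambda>n. m n \<circ> v n)" for Z :: "'b operad" and m
    using c that by (auto simp: coequalizer_def)
  interpret e: operad_morphism A B e by (rule e)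
  let ?I = "B\<lparr>Ops := \<lambda>n. e n ` Ops A n\<rparr>"
  note la = list_all2_conv_all_nth
  have m2id: "length ys = length ks \<Longrightarrow> map2 (\<lambda>n x. x) ks ys = ys" for ks :: "nat list" and ys :: "'b list"
    by (intro nth_equalityI) auto
  have I: "operad_morphism_axioms ?I B (\<lambda>n x. x)"
    by unfold_locales (auto intro: e.maps simp: m2id list_all2_lengthD)
  have S: "sym_operad ?I"
  proof (rule operad_reflect[OF e.Q.sym_operad_axioms, where J = "{\<lambda>n x. x}"])
    fix x ks ys assume x: "x \<in> Ops ?I (length ks)" and ys: "list_all2 (\<lambda>k y. y \<in> Ops ?I k) ks ys"
    obtain x' where x': "x' \<in> Ops A (length ks)" "x = e (length ks) x'" using x by auto
    define ys' where "ys' = map2 (\<lambda>k y. SOME z. z \<in> Ops A k \<and> e k z = y) ks ys"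
    have "ys' ! i \<in> Ops A (ks ! i) \<and> e (ks ! i) (ys' ! i) = ys ! i" if "i < length ks" for i
    proof -
      have "\<exists>z. z \<in> Ops A (ks ! i) \<and> e (ks ! i) z = ys ! i" using ys that by (force simp: la)
      from someI_ex[OF this] show ?thesis using ys that by (simp add: ys'_def la)
    qed
    then have l: "list_all2 (\<lambda>k y. y \<in> Ops A k) ks ys'" "map2 e ks ys' = ys"
      using ys by (auto simp: la ys'_def intro!: nth_equalityI)
    have "Compose B ks x ys = e (sum_list ks) (Compose A ks x' ys')"
      using e.pres_compose[OF x'(1) l(1)] x' l by simp
    then show "Compose ?I ks x ys \<in> Ops ?I (sum_list ks)"
      using e.P.compose_closed[OF x'(1) l(1)] by simp
  next
    show "Unit ?I \<in> Ops ?I 1" using e.pres_unit e.P.unit_closed by (simp add: image_iff) metis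
  next
    fix \<sigma> n x assume s: "\<sigma> permutes {..<n}" and "x \<in> Ops ?I n"
    then obtain x' where x': "x' \<in> Ops A n" "x = e n x'" by auto
    then show "Act ?I n \<sigma> x \<in> Ops ?I n"
      using e.pres_act[OF s x'(1)] e.P.act_closed[OF s x'(1)] by simp (metis imageI)
  qed (use I in auto)
  have eI: "operad_morphism A ?I e"
    using e.P.sym_operad_axioms S e.pres_compose e.pres_unit e.pres_act
    by (auto simp: operad_morphism_def operad_morphism_axioms_def)
  obtain k where k: "operad_morphism B ?I k" "fam_eq A (\<lambda>n. k n \<circ> e n) e"
    using univ[OF eI uv] by blast
  have kB: "operad_morphism B B k"
    using comp_operad_morphism[OF k(1), of B "\<lambda>n x. x"] I S e.Q.sym_operad_axioms
    by (simp add: operad_morphism_def comp_def)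
  obtain l where l: "\<And>k'. operad_morphism B B k' \<Longrightarrow> fam_eq A (\<lambda>n. k' n \<circ> e n) e \<Longrightarrow> fam_eq B k' l"
    using univ[OF e uv] by blast
  have "fam_eq B k l" by (rule l[OF kB k(2)])
  moreover have "fam_eq B (\<lambda>n x. x) l"
    using l[OF id_operad_morphism[OF e.Q.sym_operad_axioms]] by (simp add: fam_eq_def comp_def)
  ultimately have eq: "k n x = x" if "x \<in> Ops B n" for n x using that by (simp add: fam_eq_def)
  show "Ops B n \<subseteq> e n ` Ops A n"
    using operad_morphism.maps[OF k(1)] eq by fastforce
  show "e n ` Ops A n \<subseteq> Ops B n" using e.maps by auto
qed

theorem regular_epi_iff:
  "regular_epi A B e \<longleftrightarrow> operad_morphism A B e \<and> (\<forall>n. e n ` Ops A n = Ops B n)"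
proof
  assume "regular_epi A B e"
  then show "operad_morphism A B e \<and> (\<forall>n. e n ` Ops A n = Ops B n)"
    using coequalizer_surjective unfolding regular_epi_def by (metis coequalizer_def)
next
  assume "operad_morphism A B e \<and> (\<forall>n. e n ` Ops A n = Ops B n)"
  then show "regular_epi A B e"
    unfolding regular_epi_def
    by (intro exI[of _ "kernel_pair A e"] exI[of _ "\<lambda>n. fst"] exI[of _ "\<lambda>n. snd"] conjI
        surjective_coequalizer) auto
qed

theorem regular_epi_of_coequalizer:
  fixes R :: "'r operad" and B :: "'b operad"
  assumes "coequalizer TYPE('b) R A B u v e"
  shows "regular_epi A B e"
  using assms coequalizer_surjective[OF assms] by (auto simp: regular_epi_iff coequalizer_def)

theorem coequalizer_all_types:
  fixes A :: "'a operad" and B :: "'b operad"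
  assumes c: "coequalizer TYPE('a set) R A B u v e" and cB: "coequalizer TYPE('b) R A B u v e"
  shows "coequalizer TYPE('z) R A B u v e"
proof -
  note surj = coequalizer_surjective[OF cB]
  have "\<exists>k. operad_morphism B Z k \<and> fam_eq A (\<lambda>n. k n \<circ> e n) m \<and>
        (\<forall>k'. operad_morphism B Z k' \<and> fam_eq A (\<lambda>n. k' n \<circ> e n) m \<longrightarrow> fam_eq B k' k)"
    if m: "operad_morphism A Z m" and muv: "fam_eq R (\<lambda>n. m n \<circ> u n) (\<lambda>n. m n \<circ> v n)"
    for Z :: "'z operad" and m
  proof -
    interpret m: operad_morphism A Z m by (rule m)
    note la = list_all2_conv_all_nth
    define q where "q n x = {y \<in> Ops A n. m n y = m n x}" for n x
    define r where "r X = (SOME x. x \<in> X)" for X :: "'a set"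
    have rq: "r (q n x) \<in> Ops A n \<and> m n (r (q n x)) = m n x" if "x \<in> Ops A n" for n x
    proof -
      have "x \<in> q n x" using that by (simp add: q_def)
      then have "r (q n x) \<in> q n x" unfolding r_def by (rule someI)
      then show ?thesis by (simp add: q_def)
    qed
    define K where "K = \<lparr>Ops = (\<lambda>n. q n ` Ops A n),
      Compose = (\<lambda>ks X Ys. q (sum_list ks) (Compose A ks (r X) (map r Ys))),
      Unit = q 1 (Unit A), Act = (\<lambda>n \<sigma> X. q n (Act A n \<sigma> (r X)))\<rparr>"
    define j where "j n X = m n (r X)" for n :: nat and X
    have r: "r X \<in> Ops A n" if "X \<in> Ops K n" for X n
      using that rq by (auto simp: K_def)
    have jq: "j n (q n x) = m n x" if "x \<in> Ops A n" for n x
      using rq[OF that] by (simp add: j_def)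
    have rl: "list_all2 (\<lambda>k y. y \<in> Ops A k) ks (map r Ys)"
      if "list_all2 (\<lambda>k y. y \<in> Ops K k) ks Ys" for ks Ys
      using that r by (auto simp: la)
    have cK: "Compose K ks X Ys \<in> Ops K (sum_list ks)"
      if "X \<in> Ops K (length ks)" "list_all2 (\<lambda>k y. y \<in> Ops K k) ks Ys" for ks X Ys
      using m.P.compose_closed[OF r[OF that(1)] rl[OF that(2)]] by (simp add: K_def)
    have aK: "Act K n \<sigma> X \<in> Ops K n" if "\<sigma> permutes {..<n}" "X \<in> Ops K n" for n \<sigma> X
      using m.P.act_closed[OF that(1) r[OF that(2)]] by (simp add: K_def)
    have uK: "Unit K \<in> Ops K 1" using m.P.unit_closed by (simp add: K_def)
    have jinj: "X = Y" if "X \<in> Ops K n" "Y \<in> Ops K n" "j n X = j n Y" for n X Y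
      using that jq by (auto simp: K_def q_def)
    have jax: "operad_morphism_axioms K Z j"
    proof
      show "j n X \<in> Ops Z n" if "X \<in> Ops K n" for n X
        using r[OF that] m.maps by (simp add: j_def)
      show "j 1 (Unit K) = Unit Z"
        using jq[OF m.P.unit_closed] m.pres_unit by (simp add: K_def)
      show "j n (Act K n \<sigma> X) = Act Z n \<sigma> (j n X)" if "\<sigma> permutes {..<n}" "X \<in> Ops K n" for n \<sigma> X
        using jq[OF m.P.act_closed[OF that(1) r[OF that(2)]]] m.pres_act[OF that(1) r[OF that(2)]]
        by (simp add: K_def j_def)
      show "j (sum_list ks) (Compose K ks X Ys) = Compose Z ks (j (length ks) X) (map2 j ks Ys)"
        if "X \<in> Ops K (length ks)" "list_all2 (\<lambda>k y. y \<in> Ops K k) ks Ys" for ks X Ys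
      proof -
        have "map2 m ks (map r Ys) = map2 j ks Ys" by (intro nth_equalityI) (auto simp: j_def)
        then show ?thesis
          using jq[OF m.P.compose_closed[OF r[OF that(1)] rl[OF that(2)]]]
            m.pres_compose[OF r[OF that(1)] rl[OF that(2)]]
          by (simp add: K_def j_def)
      qed
    qed
    have K: "sym_operad K"
      by (rule operad_reflect[OF m.Q.sym_operad_axioms, where J = "{j}"]) (use cK uK aK jax jinj in auto)
    have jm: "operad_morphism K Z j"
      using K jax m.Q.sym_operad_axioms by (simp add: operad_morphism_def)
    interpret j: operad_morphism K Z j by (rule jm)
    have qK: "q n x \<in> Ops K n" if "x \<in> Ops A n" for n x using that by (simp add: K_def)
    have "operad_morphism A K q"
    proof (intro operad_morphism.intro operad_morphism_axioms.intro m.P.sym_operad_axioms K)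
      show "q n x \<in> Ops K n" if "x \<in> Ops A n" for n x using that by (rule qK)
      show "q 1 (Unit A) = Unit K" by (simp add: K_def)
      show "q n (Act A n \<sigma> x) = Act K n \<sigma> (q n x)" if s: "\<sigma> permutes {..<n}" and x: "x \<in> Ops A n" for n \<sigma> x
        using jq[OF m.P.act_closed[OF s x]] j.pres_act[OF s qK[OF x]] m.pres_act[OF s x] jq[OF x]
        by (intro jinj[OF qK[OF m.P.act_closed[OF s x]] aK[OF s qK[OF x]]]) simp
      fix x ks ys assume x: "x \<in> Ops A (length ks)" and ys: "list_all2 (\<lambda>k y. y \<in> Ops A k) ks ys"
      have l: "list_all2 (\<lambda>k y. y \<in> Ops K k) ks (map2 q ks ys)" using ys qK by (auto simp: la)
      have "map2 j ks (map2 q ks ys) = map2 m ks ys"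
        using ys jq by (intro nth_equalityI) (auto simp: la)
      then show "q (sum_list ks) (Compose A ks x ys) = Compose K ks (q (length ks) x) (map2 q ks ys)"
        using jq[OF m.P.compose_closed[OF x ys]] j.pres_compose[OF qK[OF x] l] m.pres_compose[OF x ys] jq[OF x]
        by (intro jinj[OF qK[OF m.P.compose_closed[OF x ys]] cK[OF qK[OF x] l]]) simp
    qed
    moreover have "fam_eq R (\<lambda>n. q n \<circ> u n) (\<lambda>n. q n \<circ> v n)"
      using muv by (simp add: fam_eq_def q_def)
    ultimately obtain k where k: "operad_morphism B K k" "fam_eq A (\<lambda>n. k n \<circ> e n) q"
      using c unfolding coequalizer_def by blast
    have 1: "operad_morphism B Z (\<lambda>n. j n \<circ> k n)" by (rule comp_operad_morphism[OF k(1) jm])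
    have 2: "fam_eq A (\<lambda>n. (j n \<circ> k n) \<circ> e n) m" using k(2) jq by (simp add: fam_eq_def)
    have 3: "fam_eq B k' (\<lambda>n. j n \<circ> k n)" if k': "fam_eq A (\<lambda>n. k' n \<circ> e n) m" for k'
      unfolding fam_eq_def
    proof (intro allI ballI)
      fix n y assume "y \<in> Ops B n"
      then obtain x where "x \<in> Ops A n" "y = e n x" using surj[of n] by blast
      then show "k' n y = (j n \<circ> k n) y" using k' 2 by (simp add: fam_eq_def)
    qed
    show ?thesis using 1 2 3 by blast
  qed
  then show ?thesis using c unfolding coequalizer_def by blast
qed

theorem signature_counit:
  assumes "sym_operad P"
  shows "signature P (Ops P) (counit P)"
proof -
  interpret sym_operad P by (rule assms)
  have e: "operad_morphism (free_operad (Ops P)) P (counit P)"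
    unfolding counit_def by (rule free_ext_morphism) simp
  have "x \<in> counit P n ` Ops (free_operad (Ops P)) n" if "x \<in> Ops P n" for n x
  proof
    show "x = counit P n (free_gen (Ops P) n x)"
      unfolding counit_def by (rule free_ext_gen[symmetric]) (use that in auto)
    show "free_gen (Ops P) n x \<in> Ops (free_operad (Ops P)) n"
      unfolding Ops_free_iff free_gen_def using that by (blast intro: repr_tclass wt_gen)
  qed
  then have "counit P n ` Ops (free_operad (Ops P)) n = Ops P n" for n
    using operad_morphism.maps[OF e] by blast
  then show ?thesis using e by (simp add: signature_def regular_epi_iff)
qed

subsection \<open>Cat-operads\<close>

lemma category_prod:
  assumes "category C" "category D"
  shows "category (prod_cat C D)"
proof -
  interpret C: category C by fact
  interpret D: category D by fact
  show ?thesis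
    by unfold_locales
      (use C.dom_closed C.cod_closed C.id_closed C.cmp_closed C.cmp_id_left C.cmp_id_right C.cmp_assoc
        D.dom_closed D.cod_closed D.id_closed D.cmp_closed D.cmp_id_left D.cmp_id_right D.cmp_assoc
       in \<open>auto simp: prod_cat_def Hom_def\<close>)
qed

lemma Hom_list_cat:
  "f \<in> Hom (list_cat Cs) x y \<longleftrightarrow> length f = length Cs \<and> length x = length Cs \<and> length y = length Cs \<and>
    (\<forall>i<length Cs. f ! i \<in> Hom (Cs ! i) (x ! i) (y ! i))"
  by (auto simp: Hom_def list_cat_def list_all2_conv_all_nth intro!: nth_equalityI)

lemma category_list:
  assumes "\<And>C. C \<in> set Cs \<Longrightarrow> category C"
  shows "category (list_cat Cs)"
proof -
  have c: "category (Cs ! i)" if "i < length Cs" for i using assms that by simp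
  show ?thesis
  proof
    show "Dom (list_cat Cs) f \<in> Obj (list_cat Cs)" "Cod (list_cat Cs) f \<in> Obj (list_cat Cs)"
      if "f \<in> Arr (list_cat Cs)" for f
      using that category.dom_closed[OF c] category.cod_closed[OF c]
      by (auto simp: list_cat_def list_all2_conv_all_nth)
    show "Id (list_cat Cs) x \<in> Hom (list_cat Cs) x x" if "x \<in> Obj (list_cat Cs)" for x
      using that category.id_closed[OF c]
      by (simp add: Hom_list_cat) (auto simp: list_cat_def list_all2_conv_all_nth)
    show "Cmp (list_cat Cs) g f \<in> Hom (list_cat Cs) x z"
      if "f \<in> Hom (list_cat Cs) x y" "g \<in> Hom (list_cat Cs) y z" for f g x y z
      using that category.cmp_closed[OF c]
      by (simp add: Hom_list_cat) (auto simp: list_cat_def)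
    show "Cmp (list_cat Cs) (Id (list_cat Cs) y) f = f" if "f \<in> Hom (list_cat Cs) x y" for f x y
      using that category.cmp_id_left[OF c]
      by (simp add: Hom_list_cat) (auto simp: list_cat_def intro!: nth_equalityI)
    show "Cmp (list_cat Cs) f (Id (list_cat Cs) x) = f" if "f \<in> Hom (list_cat Cs) x y" for f x y
      using that category.cmp_id_right[OF c]
      by (simp add: Hom_list_cat) (auto simp: list_cat_def intro!: nth_equalityI)
    show "Cmp (list_cat Cs) (Cmp (list_cat Cs) h g) f = Cmp (list_cat Cs) h (Cmp (list_cat Cs) g f)"
      if "f \<in> Hom (list_cat Cs) w x" "g \<in> Hom (list_cat Cs) x y" "h \<in> Hom (list_cat Cs) y z"
      for f g h w x y z
      using that
      by (simp add: Hom_list_cat) (auto simp: list_cat_def intro!: category.cmp_assoc[OF c])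
  qed
qed

lemma category_disc: "category (disc_cat X)"
  by unfold_locales (auto simp: disc_cat_def Hom_def)

lemma obj_operad_disc: "obj_operad (disc P) = P" and arr_operad_disc: "arr_operad (disc P) = P"
  by (auto simp: obj_operad_def arr_operad_def disc_def disc_cat_def)

text \<open>The category on the carrier \<open>X\<close> in which \<open>x\<close> and \<open>y\<close> have one arrow if \<open>e x = e y\<close>, else none.\<close>

definition fibre_cat :: "'a set \<Rightarrow> ('a \<Rightarrow> 'b) \<Rightarrow> ('a, 'a \<times> 'a) cat" where
  "fibre_cat X e =
    \<lparr>Obj = X, Arr = {(x, y). x \<in> X \<and> y \<in> X \<and> e x = e y}, Dom = fst, Cod = snd,
     Id = (\<lambda>x. (x, x)), Cmp = (\<lambda>g f. (fst f, snd g))\<rparr>"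

definition fibre_operad :: "'a operad \<Rightarrow> (nat \<Rightarrow> 'a \<Rightarrow> 'b) \<Rightarrow> ('a, 'a \<times> 'a) cat_operad" where
  "fibre_operad A e =
    \<lparr>Lev = (\<lambda>n. fibre_cat (Ops A n) (e n)),
     ComposeO = Compose A, ComposeA = Compose (kernel_pair A e),
     UnitO = Unit A, ActO = Act A, ActA = Act (kernel_pair A e)\<rparr>"

lemma category_fibre: "category (fibre_cat X e)"
  by unfold_locales (auto simp: fibre_cat_def Hom_def)

lemma obj_fibre_operad: "obj_operad (fibre_operad A e) = A"
  and arr_fibre_operad: "arr_operad (fibre_operad A e) = kernel_pair A e"
  by (auto simp: obj_operad_def arr_operad_def fibre_operad_def fibre_cat_def kernel_pair_def)

lemma category_inputs:
  "(\<And>n. category (L n)) \<Longrightarrow> category (prod_cat (L (length ks)) (list_cat (map L ks)))"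
  by (intro category_prod category_list) auto

lemma sym_cat_operad_disc:
  assumes "sym_operad P"
  shows "sym_cat_operad (disc P)"
proof (rule sym_cat_operad.intro)
  interpret sym_operad P by fact
  show cat: "category (Lev (disc P) n)" for n by (simp add: disc_def category_disc)
  show "sym_operad (obj_operad (disc P))" "sym_operad (arr_operad (disc P))"
    using assms by (simp_all add: obj_operad_disc arr_operad_disc)
  show "cat_functor (Lev (disc P) n) (Lev (disc P) n) (ActO (disc P) n \<sigma>) (ActA (disc P) n \<sigma>)"
    if "\<sigma> permutes {..<n}" for \<sigma> n
    using act_closed[OF that]
    by (intro cat_functor.intro cat cat_functor_axioms.intro) (auto simp: disc_def disc_cat_def Hom_def)
  fix ks
  show "cat_functor (prod_cat (Lev (disc P) (length ks)) (list_cat (map (Lev (disc P)) ks)))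
      (Lev (disc P) (sum_list ks))
      (\<lambda>(x, ys). ComposeO (disc P) ks x ys) (\<lambda>(f, gs). ComposeA (disc P) ks f gs)"
  proof (intro cat_functor.intro category_inputs cat cat_functor_axioms.intro)
    fix f x y assume f: "f \<in> Hom (prod_cat (Lev (disc P) (length ks)) (list_cat (map (Lev (disc P)) ks))) x y"
    then have "snd x = map2 Dom (map (Lev (disc P)) ks) (snd f)"
        "snd y = map2 Cod (map (Lev (disc P)) ks) (snd f)"
      and o: "fst f \<in> Ops P (length ks)" "fst x = fst f" "fst y = fst f"
        "list_all2 (\<lambda>k y. y \<in> Ops P k) ks (snd f)"
      by (auto simp: prod_cat_def list_cat_def Hom_def disc_def disc_cat_def list_all2_conv_all_nth)
    moreover have "map2 Dom (map (Lev (disc P)) ks) (snd f) = snd f"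
        "map2 Cod (map (Lev (disc P)) ks) (snd f) = snd f"
      using list_all2_lengthD[OF o(4)]
      by (auto simp: disc_def disc_cat_def intro!: nth_equalityI)
    ultimately show "(case f of (f, gs) \<Rightarrow> ComposeA (disc P) ks f gs)
      \<in> Hom (Lev (disc P) (sum_list ks)) (case x of (x, ys) \<Rightarrow> ComposeO (disc P) ks x ys)
          (case y of (x, ys) \<Rightarrow> ComposeO (disc P) ks x ys)"
      using compose_closed[OF o(1,4)] o
      by (simp add: case_prod_beta) (simp add: Hom_def disc_def disc_cat_def)
  next
    fix f g x y z
    let ?I = "prod_cat (Lev (disc P) (length ks)) (list_cat (map (Lev (disc P)) ks))"
    assume "f \<in> Hom ?I x y" "g \<in> Hom ?I y z"
    then have "fst (Cmp ?I g f) = fst f" and l: "length (snd f) = length ks"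
      by (auto simp: prod_cat_def list_cat_def Hom_def disc_def disc_cat_def list_all2_conv_all_nth)
    moreover have "snd (Cmp ?I g f) = snd f"
      using l by (auto simp: prod_cat_def list_cat_def disc_def disc_cat_def case_prod_beta
          intro!: nth_equalityI)
    ultimately show "(case Cmp ?I g f of (f, gs) \<Rightarrow> ComposeA (disc P) ks f gs) =
      Cmp (Lev (disc P) (sum_list ks)) (case g of (f, gs) \<Rightarrow> ComposeA (disc P) ks f gs)
        (case f of (f, gs) \<Rightarrow> ComposeA (disc P) ks f gs)"
      by (simp add: case_prod_beta) (simp add: disc_def disc_cat_def)
  next
    fix x
    let ?I = "prod_cat (Lev (disc P) (length ks)) (list_cat (map (Lev (disc P)) ks))"
    assume x: "x \<in> Obj ?I"
    then have o: "fst x \<in> Ops P (length ks)" "list_all2 (\<lambda>k y. y \<in> Ops P k) ks (snd x)"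
      by (auto simp: prod_cat_def list_cat_def disc_def disc_cat_def list_all2_conv_all_nth)
    show "(case x of (x, ys) \<Rightarrow> ComposeO (disc P) ks x ys) \<in> Obj (Lev (disc P) (sum_list ks))"
      using compose_closed[OF o] by (simp add: case_prod_beta) (simp add: disc_def disc_cat_def)
    have "fst (Id ?I x) = fst x"
      by (simp add: prod_cat_def disc_def disc_cat_def)
    moreover have "snd (Id ?I x) = snd x"
      using list_all2_lengthD[OF o(2)]
      by (auto simp: prod_cat_def list_cat_def disc_def disc_cat_def intro!: nth_equalityI)
    ultimately show "(case Id ?I x of (f, gs) \<Rightarrow> ComposeA (disc P) ks f gs) =
        Id (Lev (disc P) (sum_list ks)) (case x of (x, ys) \<Rightarrow> ComposeO (disc P) ks x ys)"
      by (simp add: case_prod_beta) (simp add: disc_def disc_cat_def)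
  qed
qed

lemma sym_cat_operad_fibre:
  assumes e: "operad_morphism A B e"
  shows "sym_cat_operad (fibre_operad A e)"
proof (rule sym_cat_operad.intro)
  let ?Q = "fibre_operad A e"
  let ?K = "kernel_pair A e"
  interpret e: operad_morphism A B e by fact
  interpret K: sym_operad ?K using kernel_pair_operad[OF e] by simp
  note la = list_all2_conv_all_nth
  show cat: "category (Lev ?Q n)" for n by (simp add: fibre_operad_def category_fibre)
  show "sym_operad (obj_operad ?Q)" "sym_operad (arr_operad ?Q)"
    using e.P.sym_operad_axioms K.sym_operad_axioms by (simp_all add: obj_fibre_operad arr_fibre_operad)
  show "cat_functor (Lev ?Q n) (Lev ?Q n) (ActO ?Q n \<sigma>) (ActA ?Q n \<sigma>)"
    if "\<sigma> permutes {..<n}" for \<sigma> n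
    using e.P.act_closed[OF that] e.pres_act[OF that]
    by (intro cat_functor.intro cat cat_functor_axioms.intro)
      (auto simp: fibre_operad_def fibre_cat_def Hom_def kernel_pair_def)
  fix ks
  let ?I = "prod_cat (Lev ?Q (length ks)) (list_cat (map (Lev ?Q) ks))"
  have ArrI: "f \<in> Arr ?I \<longleftrightarrow> fst f \<in> Ops ?K (length ks) \<and> list_all2 (\<lambda>k y. y \<in> Ops ?K k) ks (snd f)" for f
    by (cases f) (auto simp: prod_cat_def list_cat_def fibre_operad_def fibre_cat_def kernel_pair_def la)
  have DomI: "Dom ?I f = (fst (fst f), map fst (snd f))" "Cod ?I f = (snd (fst f), map snd (snd f))"
    if "f \<in> Arr ?I" for f
    using that by (cases f, auto simp: prod_cat_def list_cat_def fibre_operad_def fibre_cat_def la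
        intro!: nth_equalityI)+
  have LevQ: "Hom (Lev ?Q n) x y = {f \<in> Ops ?K n. fst f = x \<and> snd f = y}" for n x y
    by (auto simp: Hom_def fibre_operad_def fibre_cat_def kernel_pair_def)
  show "cat_functor ?I (Lev ?Q (sum_list ks))
      (\<lambda>(x, ys). ComposeO ?Q ks x ys) (\<lambda>(f, gs). ComposeA ?Q ks f gs)"
  proof (intro cat_functor.intro category_inputs cat cat_functor_axioms.intro)
    fix x assume x: "x \<in> Obj ?I"
    then show "(case x of (x, ys) \<Rightarrow> ComposeO ?Q ks x ys) \<in> Obj (Lev ?Q (sum_list ks))"
      by (auto simp: prod_cat_def list_cat_def fibre_operad_def fibre_cat_def la intro!: e.P.compose_closed)
    have l: "length (snd x) = length ks"
      using x by (auto simp: prod_cat_def list_cat_def la)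
    have "map fst (map2 Id (map (Lev ?Q) ks) (snd x)) = snd x"
      "map snd (map2 Id (map (Lev ?Q) ks) (snd x)) = snd x"
      using l by (auto simp: fibre_operad_def fibre_cat_def intro!: nth_equalityI)
    then show "(case Id ?I x of (f, gs) \<Rightarrow> ComposeA ?Q ks f gs) =
        Id (Lev ?Q (sum_list ks)) (case x of (x, ys) \<Rightarrow> ComposeO ?Q ks x ys)"
      by (cases x) (simp add: prod_cat_def list_cat_def fibre_operad_def fibre_cat_def kernel_pair_def)
  next
    fix f x y assume f: "f \<in> Hom ?I x y"
    then have fa: "f \<in> Arr ?I" and xy: "Dom ?I f = x" "Cod ?I f = y" by (auto simp: Hom_def)
    have "Compose ?K ks (fst f) (snd f) \<in> Ops ?K (sum_list ks)"
      using fa unfolding ArrI by (intro K.compose_closed) auto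
    then show "(case f of (f, gs) \<Rightarrow> ComposeA ?Q ks f gs) \<in> Hom (Lev ?Q (sum_list ks))
        (case x of (x, ys) \<Rightarrow> ComposeO ?Q ks x ys) (case y of (x, ys) \<Rightarrow> ComposeO ?Q ks x ys)"
      unfolding LevQ xy[symmetric] DomI[OF fa] case_prod_beta
      by (simp add: fibre_operad_def) (simp add: kernel_pair_def)
  next
    fix f g x y z assume "f \<in> Hom ?I x y" "g \<in> Hom ?I y z"
    then have fa: "f \<in> Arr ?I" and ga: "g \<in> Arr ?I" by (auto simp: Hom_def)
    have l: "length (snd f) = length ks" "length (snd g) = length ks"
      using fa ga unfolding ArrI by (metis list_all2_lengthD)+
    have "fst (Cmp ?I g f) = (fst (fst f), snd (fst g))"
      by (simp add: prod_cat_def list_cat_def fibre_operad_def fibre_cat_def case_prod_beta)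
    moreover have "map fst (snd (Cmp ?I g f)) = map fst (snd f)" "map snd (snd (Cmp ?I g f)) = map snd (snd g)"
      using l by (auto simp: prod_cat_def list_cat_def fibre_operad_def fibre_cat_def case_prod_beta
          intro!: nth_equalityI)
    ultimately show "(case Cmp ?I g f of (f, gs) \<Rightarrow> ComposeA ?Q ks f gs) =
      Cmp (Lev ?Q (sum_list ks)) (case g of (f, gs) \<Rightarrow> ComposeA ?Q ks f gs)
        (case f of (f, gs) \<Rightarrow> ComposeA ?Q ks f gs)"
      unfolding case_prod_beta by (simp add: fibre_operad_def fibre_cat_def kernel_pair_def)
  qed
qed

theorem is_categorification_exists:
  fixes P :: "'p operad" and \<Phi> :: "nat \<Rightarrow> 's set"
  assumes P: "sym_operad P" and \<phi>: "signature P \<Phi> \<phi>"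
  shows "is_categorification P \<Phi> \<phi> (fibre_operad (free_operad \<Phi>) \<phi>)"
proof -
  let ?F = "free_operad \<Phi>"
  let ?K = "kernel_pair ?F \<phi>"
  let ?Q = "fibre_operad ?F \<phi>"
  define b :: "('s opterm set, 's opterm set, 's opterm set, 's opterm set \<times> 's opterm set) functor_family"
    where "b = \<lparr>onObj = (\<lambda>n x. x), onArr = (\<lambda>n x. (x, x))\<rparr>"
  define f where "f = \<lparr>onObj = \<phi>, onArr = (\<lambda>n (p :: 's opterm set \<times> 's opterm set). \<phi> n (fst p))\<rparr>"
  have e: "operad_morphism ?F P \<phi>" using \<phi> by (simp add: signature_def regular_epi_iff)
  interpret e: operad_morphism ?F P \<phi> by fact
  note Q = sym_cat_operad_fibre[OF e] and F = sym_cat_operad_disc[OF sym_operad_free, of \<Phi>]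
    and dP = sym_cat_operad_disc[OF P]
  have dup: "map fst (map2 (\<lambda>n x. (x, x)) ks ys) = ys" "map snd (map2 (\<lambda>n x. (x, x)) ks ys) = ys"
    if "length ys = length ks" for ks :: "nat list" and ys :: "'s opterm set list"
    using that by (auto intro!: nth_equalityI)
  have "operad_morphism_axioms ?F ?K (\<lambda>n x. (x, x))"
  proof
    fix x ks ys assume "list_all2 (\<lambda>k y. y \<in> Ops ?F k) ks ys"
    then have "length ys = length ks" by (simp add: list_all2_lengthD)
    from dup[OF this] show "(Compose ?F ks x ys, Compose ?F ks x ys) =
        Compose ?K ks (x, x) (map2 (\<lambda>n x. (x, x)) ks ys)"
      unfolding kernel_pair_def operad.simps fst_conv snd_conv by (simp only:)
  qed (simp_all add: kernel_pair_def)
  then have bK: "operad_morphism ?F ?K (\<lambda>n x. (x, x))"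
    using kernel_pair_operad(1)[OF e] sym_operad_free by (auto simp: operad_morphism_def)
  have "cat_operad_morphism (disc ?F) ?Q b"
  proof (intro cat_operad_morphism.intro cat_operad_morphism_axioms.intro F Q)
    show "operad_morphism (obj_operad (disc ?F)) (obj_operad ?Q) (onObj b)"
      using id_operad_morphism[OF sym_operad_free] by (simp add: obj_operad_disc obj_fibre_operad b_def)
    show "operad_morphism (arr_operad (disc ?F)) (arr_operad ?Q) (onArr b)"
      using bK by (simp add: arr_operad_disc arr_fibre_operad b_def)
    show "cat_functor (Lev (disc ?F) n) (Lev ?Q n) (onObj b n) (onArr b n)" for n
      by (intro cat_functor.intro sym_cat_operad.lev_category F Q cat_functor_axioms.intro)
        (auto simp: disc_def disc_cat_def fibre_operad_def fibre_cat_def b_def Hom_def)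
  qed
  moreover have "cat_operad_morphism ?Q (disc P) f"
  proof (intro cat_operad_morphism.intro cat_operad_morphism_axioms.intro dP Q)
    show "operad_morphism (obj_operad ?Q) (obj_operad (disc P)) (onObj f)"
      using e by (simp add: obj_operad_disc obj_fibre_operad f_def)
    show "operad_morphism (arr_operad ?Q) (arr_operad (disc P)) (onArr f)"
      using comp_operad_morphism[OF kernel_pair_operad(2)[OF e] e]
      by (simp add: arr_operad_disc arr_fibre_operad f_def comp_def)
    show "cat_functor (Lev ?Q n) (Lev (disc P) n) (onObj f n) (onArr f n)" for n
      by (intro cat_functor.intro sym_cat_operad.lev_category dP Q cat_functor_axioms.intro)
        (auto simp: disc_def disc_cat_def fibre_operad_def fibre_cat_def f_def Hom_def e.maps)
  qed
  moreover have "lev_bij_on_objects (disc ?F) ?Q b"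
    by (auto simp: lev_bij_on_objects_def disc_def disc_cat_def fibre_operad_def fibre_cat_def b_def bij_betw_def)
  moreover have "lev_full_faithful ?Q (disc P) f"
    by (auto simp: lev_full_faithful_def full_faithful_def disc_def disc_cat_def fibre_operad_def
        fibre_cat_def f_def Hom_def bij_betw_def inj_on_def e.maps)
  moreover have "morphism_eq (disc ?F) (comp_morphism f b) (disc_morphism \<phi>)"
    by (auto simp: morphism_eq_def fam_eq_def comp_morphism_def disc_morphism_def f_def b_def)
  ultimately show ?thesis unfolding is_categorification_def by blast
qed

end

theory Submission
  imports Defs
begin

text \<open>
  A categorification \<open>Q\<close> of \<open>P\<close> maps fully and faithfully to the discrete Cat-operad \<open>P\<close>. So
  between two objects of \<open>Q\<close> there is exactly one arrow if they lie over the same operation of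
  \<open>P\<close>, and none otherwise: each fibre of \<open>Q\<close> over \<open>P\<close> is a chaotic category. Two consequences
  follow, because every equation between parallel arrows holds automatically. A map of object
  operads over \<open>P\<close> extends to a morphism of Cat-operads
  (\<open>chaotic_fibres.extend_obj_morphism\<close>), and any two morphisms with the same composite to
  \<open>P\<close> are isomorphic (\<open>chaotic_fibres.isomorphic_over\<close>).

  It remains to produce maps over \<open>P\<close> between the object operads of two categorifications, in
  both directions. The object operad of \<open>Q\<close> is isomorphic to the free operad on the signature,
  hence projective with respect to levelwise surjections (\<open>obj_operad_projective\<close>). The
  object operad of the other categorification maps onto \<open>P\<close>, since its signature is a regular
  epimorphism and thus levelwise surjective; so the projection of \<open>Q\<close> to \<open>P\<close> lifts along it. The
  two morphisms obtained this way compose to endomorphisms over \<open>P\<close>, which are isomorphic to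
  the identities. The argument is symmetric in the two signatures, so any two categorifications
  of \<open>P\<close> are equivalent (\<open>categorifications_equivalent\<close>); the unbiased one is the
  categorification for the signature given by the counit.
\<close>

section \<open>Morphisms of Cat-operads\<close>

lemma id_cat_operad_morphism: "sym_cat_operad E \<Longrightarrow> cat_operad_morphism E E id_morphism"
  by (intro cat_operad_morphism.intro cat_operad_morphism_axioms.intro cat_functor.intro
      cat_functor_axioms.intro)
    (auto simp: id_morphism_def sym_cat_operad.lev_category
      intro!: id_operad_morphism sym_cat_operad.obj_sym_operad sym_cat_operad.arr_sym_operad)

lemma comp_cat_operad_morphism:
  assumes F: "cat_operad_morphism A B F" and G: "cat_operad_morphism B C G"
  shows "cat_operad_morphism A C (comp_morphism G F)"
proof -
  interpret F: cat_operad_morphism A B F by (rule F)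
  interpret G: cat_operad_morphism B C G by (rule G)
  show ?thesis
  proof (intro cat_operad_morphism.intro cat_operad_morphism_axioms.intro
      F.P.sym_cat_operad_axioms G.Q.sym_cat_operad_axioms)
    fix n
    interpret Fn: cat_functor "Lev A n" "Lev B n" "onObj F n" "onArr F n" by (rule F.lev_functor)
    interpret Gn: cat_functor "Lev B n" "Lev C n" "onObj G n" "onArr G n" by (rule G.lev_functor)
    show "cat_functor (Lev A n) (Lev C n) (onObj (comp_morphism G F) n) (onArr (comp_morphism G F) n)"
    proof
      show "onArr (comp_morphism G F) n (Cmp (Lev A n) v u) =
          Cmp (Lev C n) (onArr (comp_morphism G F) n v) (onArr (comp_morphism G F) n u)"
        if "u \<in> Hom (Lev A n) x y" "v \<in> Hom (Lev A n) y z" for u v x y z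
        using Fn.pres_cmp[OF that] Gn.pres_cmp[OF that[THEN Fn.arr_maps]] by (simp add: comp_morphism_def)
    qed (simp_all add: comp_morphism_def Fn.pres_id Gn.pres_id Fn.obj_maps Gn.obj_maps
          Fn.arr_maps Gn.arr_maps)
  qed (use comp_operad_morphism[OF F.obj_morphism G.obj_morphism]
        comp_operad_morphism[OF F.arr_morphism G.arr_morphism] in \<open>simp_all add: comp_morphism_def\<close>)
qed

context sym_cat_operad
begin

lemma ComposeA_Hom:
  assumes f: "f \<in> Hom (Lev P (length ks)) x y"
    and len: "length gs = length ks" "length xs = length ks" "length ys = length ks"
    and gs: "\<And>i. i < length ks \<Longrightarrow> gs ! i \<in> Hom (Lev P (ks ! i)) (xs ! i) (ys ! i)"
  shows "ComposeA P ks f gs \<in> Hom (Lev P (sum_list ks)) (ComposeO P ks x xs) (ComposeO P ks y ys)"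
proof -
  have "gs \<in> Hom (list_cat (map (Lev P) ks)) xs ys"
    using len gs by (simp add: Hom_list_cat)
  then have "(f, gs) \<in> Hom (prod_cat (Lev P (length ks)) (list_cat (map (Lev P) ks))) (x, xs) (y, ys)"
    using f by (simp add: prod_cat_def Hom_def)
  from cat_functor.arr_maps[OF compose_functor this] show ?thesis by simp
qed

lemma ActA_Hom:
  "\<lbrakk>\<sigma> permutes {..<n}; f \<in> Hom (Lev P n) x y\<rbrakk>
    \<Longrightarrow> ActA P n \<sigma> f \<in> Hom (Lev P n) (ActO P n \<sigma> x) (ActO P n \<sigma> y)"
  using cat_functor.arr_maps[OF act_functor] by blast

lemma UnitO_Obj: "UnitO P \<in> Obj (Lev P 1)"
  using sym_operad.unit_closed[OF obj_sym_operad] by (simp add: obj_operad_def)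

lemma Hom_Obj: "f \<in> Hom (Lev P n) x y \<Longrightarrow> x \<in> Obj (Lev P n) \<and> y \<in> Obj (Lev P n)"
  using category.dom_closed[OF lev_category] category.cod_closed[OF lev_category]
  by (auto simp: Hom_def)

end

context cat_operad_morphism
begin

lemma onObj_Obj: "x \<in> Obj (Lev P n) \<Longrightarrow> onObj F n x \<in> Obj (Lev Q n)"
  by (rule cat_functor.obj_maps[OF lev_functor])

lemma onArr_Hom: "f \<in> Hom (Lev P n) x y \<Longrightarrow> onArr F n f \<in> Hom (Lev Q n) (onObj F n x) (onObj F n y)"
  by (rule cat_functor.arr_maps[OF lev_functor])

lemma onObj_ComposeO:
  "\<lbrakk>x \<in> Obj (Lev P (length ks)); list_all2 (\<lambda>k y. y \<in> Obj (Lev P k)) ks ys\<rbrakk>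
    \<Longrightarrow> onObj F (sum_list ks) (ComposeO P ks x ys) =
        ComposeO Q ks (onObj F (length ks) x) (map2 (onObj F) ks ys)"
  using operad_morphism.pres_compose[OF obj_morphism, of x ks ys] by (simp add: obj_operad_def)

lemma onObj_UnitO: "onObj F 1 (UnitO P) = UnitO Q"
  using operad_morphism.pres_unit[OF obj_morphism] by (simp add: obj_operad_def)

lemma onObj_ActO:
  "\<lbrakk>\<sigma> permutes {..<n}; x \<in> Obj (Lev P n)\<rbrakk> \<Longrightarrow> onObj F n (ActO P n \<sigma> x) = ActO Q n \<sigma> (onObj F n x)"
  using operad_morphism.pres_act[OF obj_morphism, of \<sigma> n x] by (simp add: obj_operad_def)

end


section \<open>Cat-operads with chaotic fibres\<close>

text \<open>
  The map \<open>p\<close> assigns to each object the point over which it lies. It is a bare family of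
  functions, because the arguments below see only its fibres.
\<close>

locale chaotic_fibres = sym_cat_operad E for E :: "('o, 'm) cat_operad" +
  fixes p :: "nat \<Rightarrow> 'o \<Rightarrow> 'b"
  assumes ex1_arrow:
    "\<lbrakk>x \<in> Obj (Lev E n); y \<in> Obj (Lev E n); p n x = p n y\<rbrakk> \<Longrightarrow> \<exists>!u. u \<in> Hom (Lev E n) x y"
  and arrow_in_fibre: "u \<in> Hom (Lev E n) x y \<Longrightarrow> p n x = p n y"
begin

definition arrow :: "nat \<Rightarrow> 'o \<Rightarrow> 'o \<Rightarrow> 'm" where
  "arrow n x y = (THE u. u \<in> Hom (Lev E n) x y)"

lemma arrow_Hom:
  "\<lbrakk>x \<in> Obj (Lev E n); y \<in> Obj (Lev E n); p n x = p n y\<rbrakk> \<Longrightarrow> arrow n x y \<in> Hom (Lev E n) x y"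
  unfolding arrow_def by (rule theI', rule ex1_arrow)

lemma parallel_eq:
  "\<lbrakk>u \<in> Hom (Lev E n) x y; v \<in> Hom (Lev E n) x y\<rbrakk> \<Longrightarrow> u = v"
  using ex1_arrow[of x n y] arrow_in_fibre[of u n x y] Hom_Obj[of u n x y] by blast

lemma arrow_eqI: "u \<in> Hom (Lev E n) x y \<Longrightarrow> arrow n x y = u"
  using parallel_eq unfolding arrow_def by blast

text \<open>
  An arrow \<open>u : x \<rightarrow> y\<close> of \<open>A\<close> is sent to the unique arrow from the image of \<open>x\<close> to the image of
  \<open>y\<close>. Functoriality and compatibility with the operad structure are equations between parallel
  arrows.
\<close>

lemma extend_obj_morphism:
  fixes A :: "('o2, 'm2) cat_operad"
  assumes A: "chaotic_fibres A q"
    and g: "operad_morphism (obj_operad A) (obj_operad E) g"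
    and over: "\<And>n x. x \<in> Obj (Lev A n) \<Longrightarrow> p n (g n x) = q n x"
  obtains F :: "('o2, 'm2, 'o, 'm) functor_family"
    where "cat_operad_morphism A E F" "onObj F = g"
proof -
  interpret A: chaotic_fibres A q by (rule A)
  interpret g: operad_morphism "obj_operad A" "obj_operad E" g by (rule g)
  let ?G = "\<lambda>n u. arrow n (g n (Dom (Lev A n) u)) (g n (Cod (Lev A n) u))"
  define F where "F = \<lparr>onObj = g, onArr = ?G\<rparr>"
  have gO: "g n x \<in> Obj (Lev E n)" if "x \<in> Obj (Lev A n)" for n x
    using g.maps[of x n] that by (simp add: obj_operad_def)
  have gH: "?G n u \<in> Hom (Lev E n) (g n x) (g n y)" if u: "u \<in> Hom (Lev A n) x y" for n u x y
  proof -
    have "p n (g n x) = p n (g n y)"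
      using A.arrow_in_fibre[OF u] A.Hom_Obj[OF u] over by simp
    then show ?thesis
      using arrow_Hom[of "g n x" n "g n y"] gO A.Hom_Obj[OF u] u by (simp add: Hom_def)
  qed
  have Hom_self: "u \<in> Hom (Lev A n) (Dom (Lev A n) u) (Cod (Lev A n) u)" if "u \<in> Arr (Lev A n)" for n u
    using that by (simp add: Hom_def)
  have GI: "?G n u = v" if "u \<in> Hom (Lev A n) x y" "v \<in> Hom (Lev E n) (g n x) (g n y)" for n u v x y
    using parallel_eq[OF gH[OF that(1)] that(2)] .
  have lev: "cat_functor (Lev A n) (Lev E n) (g n) (?G n)" for n
  proof -
    interpret An: category "Lev A n" by (rule A.lev_category)
    interpret En: category "Lev E n" by (rule lev_category)
    show ?thesis
    proof
      show "?G n (Cmp (Lev A n) v u) = Cmp (Lev E n) (?G n v) (?G n u)"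
        if "u \<in> Hom (Lev A n) x y" "v \<in> Hom (Lev A n) y z" for u v x y z
        by (rule GI[OF An.cmp_closed[OF that] En.cmp_closed[OF that[THEN gH]]])
      show "?G n (Id (Lev A n) x) = Id (Lev E n) (g n x)" if "x \<in> Obj (Lev A n)" for x
        by (rule GI[OF An.id_closed[OF that] En.id_closed[OF gO[OF that]]])
    qed (fact gO gH)+
  qed
  have "operad_morphism (arr_operad A) (arr_operad E) ?G"
  proof (intro operad_morphism.intro A.arr_sym_operad arr_sym_operad operad_morphism_axioms.intro)
    show "?G n u \<in> Ops (arr_operad E) n" if "u \<in> Ops (arr_operad A) n" for u n
      using that gH[OF Hom_self, of u n] by (simp add: arr_operad_def Hom_def)
    have "Id (Lev A 1) (UnitO A) \<in> Hom (Lev A 1) (UnitO A) (UnitO A)"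
      by (rule category.id_closed[OF A.lev_category A.UnitO_Obj])
    moreover have "Id (Lev E 1) (UnitO E) \<in> Hom (Lev E 1) (g 1 (UnitO A)) (g 1 (UnitO A))"
      using category.id_closed[OF lev_category UnitO_Obj] g.pres_unit by (simp add: obj_operad_def)
    ultimately have "?G 1 (Id (Lev A 1) (UnitO A)) = Id (Lev E 1) (UnitO E)" by (rule GI)
    then show "?G 1 (Unit (arr_operad A)) = Unit (arr_operad E)" by (simp add: arr_operad_def)
    show "?G n (Act (arr_operad A) n \<sigma> u) = Act (arr_operad E) n \<sigma> (?G n u)"
      if s: "\<sigma> permutes {..<n}" and u: "u \<in> Ops (arr_operad A) n" for \<sigma> n u
    proof -
      have h: "u \<in> Hom (Lev A n) (Dom (Lev A n) u) (Cod (Lev A n) u)"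
        using u Hom_self by (simp add: arr_operad_def)
      have "g n (ActO A n \<sigma> x) = ActO E n \<sigma> (g n x)" if "x \<in> Obj (Lev A n)" for x
        using g.pres_act[OF s, of x] that by (simp add: obj_operad_def)
      then have "?G n (ActA A n \<sigma> u) = ActA E n \<sigma> (?G n u)"
        using GI[OF A.ActA_Hom[OF s h]] ActA_Hom[OF s gH[OF h]] A.Hom_Obj[OF h] by simp
      then show ?thesis by (simp add: arr_operad_def)
    qed
    fix u us and ks :: "nat list"
    let ?x = "Dom (Lev A (length ks)) u" and ?y = "Cod (Lev A (length ks)) u"
    assume "u \<in> Ops (arr_operad A) (length ks)"
      and "list_all2 (\<lambda>k v. v \<in> Ops (arr_operad A) k) ks us"
    then have u: "u \<in> Hom (Lev A (length ks)) ?x ?y"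
      and len: "length us = length ks"
      and us: "\<And>i. i < length ks \<Longrightarrow>
        us ! i \<in> Hom (Lev A (ks ! i)) (Dom (Lev A (ks ! i)) (us ! i)) (Cod (Lev A (ks ! i)) (us ! i))"
      using Hom_self by (auto simp: arr_operad_def list_all2_conv_all_nth)
    let ?xs = "map2 (\<lambda>k. Dom (Lev A k)) ks us" and ?ys = "map2 (\<lambda>k. Cod (Lev A k)) ks us"
    have gc: "g (sum_list ks) (ComposeO A ks x xs) = ComposeO E ks (g (length ks) x) (map2 g ks xs)"
      if "x \<in> Obj (Lev A (length ks))" "list_all2 (\<lambda>k y. y \<in> Obj (Lev A k)) ks xs" for x xs
      using g.pres_compose[of x ks xs] that by (simp add: obj_operad_def)
    have xys: "list_all2 (\<lambda>k y. y \<in> Obj (Lev A k)) ks ?xs" "list_all2 (\<lambda>k y. y \<in> Obj (Lev A k)) ks ?ys"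
      using len A.Hom_Obj[OF us] by (auto simp: list_all2_conv_all_nth)
    have "ComposeA A ks u us \<in> Hom (Lev A (sum_list ks)) (ComposeO A ks ?x ?xs) (ComposeO A ks ?y ?ys)"
      using len us by (intro A.ComposeA_Hom u) auto
    moreover have "ComposeA E ks (?G (length ks) u) (map2 ?G ks us) \<in> Hom (Lev E (sum_list ks))
        (ComposeO E ks (g (length ks) ?x) (map2 g ks ?xs)) (ComposeO E ks (g (length ks) ?y) (map2 g ks ?ys))"
      using len gH[OF us] by (intro ComposeA_Hom gH[OF u]) auto
    ultimately have "?G (sum_list ks) (ComposeA A ks u us) =
        ComposeA E ks (?G (length ks) u) (map2 ?G ks us)"
      using gc[OF _ xys(1)] gc[OF _ xys(2)] A.Hom_Obj[OF u] by (intro GI) auto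
    then show "?G (sum_list ks) (Compose (arr_operad A) ks u us) =
        Compose (arr_operad E) ks (?G (length ks) u) (map2 ?G ks us)"
      by (simp add: arr_operad_def)
  qed
  then have "cat_operad_morphism A E F"
    using lev g A.sym_cat_operad_axioms sym_cat_operad_axioms
    by (intro cat_operad_morphism.intro cat_operad_morphism_axioms.intro) (simp_all add: F_def)
  then show ?thesis using that[of F] by (simp add: F_def)
qed

text \<open>
  The component at \<open>x\<close> is the unique arrow between the two images of \<open>x\<close>. Naturality and the
  axioms for transformations are again equations between parallel arrows.
\<close>

lemma transformation_over:
  assumes F: "cat_operad_morphism A E F" and G: "cat_operad_morphism A E G"
    and over: "\<And>n x. x \<in> Obj (Lev A n) \<Longrightarrow> p n (onObj F n x) = p n (onObj G n x)"
  shows "transformation A E F G (\<lambda>n x. arrow n (onObj F n x) (onObj G n x))"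
proof -
  interpret F: cat_operad_morphism A E F by (rule F)
  interpret G: cat_operad_morphism A E G by (rule G)
  let ?\<alpha> = "\<lambda>n x. arrow n (onObj F n x) (onObj G n x)"
  have \<alpha>: "?\<alpha> n x \<in> Hom (Lev E n) (onObj F n x) (onObj G n x)" if "x \<in> Obj (Lev A n)" for n x
    using that by (intro arrow_Hom F.onObj_Obj G.onObj_Obj over)
  show ?thesis
  proof (intro transformation.intro F G transformation_axioms.intro)
    fix n
    interpret En: category "Lev E n" by (rule lev_category)
    have "Cmp (Lev E n) (?\<alpha> n y) (onArr F n u) = Cmp (Lev E n) (onArr G n u) (?\<alpha> n x)"
      if u: "u \<in> Hom (Lev A n) x y" for x y u
      using F.P.Hom_Obj[OF u] F.onArr_Hom[OF u] G.onArr_Hom[OF u] \<alpha>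
      by (blast intro: parallel_eq En.cmp_closed)
    then show "natural (Lev A n) (Lev E n) (onObj F n) (onArr F n) (onObj G n) (onArr G n) (?\<alpha> n)"
      unfolding natural_def using \<alpha> by blast
  next
    fix x ks ys assume x: "x \<in> Obj (Lev A (length ks))"
      and ys: "list_all2 (\<lambda>k y. y \<in> Obj (Lev A k)) ks ys"
    have "ComposeA E ks (?\<alpha> (length ks) x) (map2 ?\<alpha> ks ys) \<in> Hom (Lev E (sum_list ks))
        (ComposeO E ks (onObj F (length ks) x) (map2 (onObj F) ks ys))
        (ComposeO E ks (onObj G (length ks) x) (map2 (onObj G) ks ys))"
      using ys by (intro ComposeA_Hom \<alpha> x) (auto simp: list_all2_conv_all_nth intro: \<alpha>)
    then show "?\<alpha> (sum_list ks) (ComposeO A ks x ys) =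
        ComposeA E ks (?\<alpha> (length ks) x) (map2 ?\<alpha> ks ys)"
      unfolding F.onObj_ComposeO[OF x ys] G.onObj_ComposeO[OF x ys] by (rule arrow_eqI)
  next
    show "?\<alpha> 1 (UnitO A) = Id (Lev E 1) (UnitO E)"
      unfolding F.onObj_UnitO G.onObj_UnitO
      by (rule arrow_eqI[OF category.id_closed[OF lev_category UnitO_Obj]])
  next
    fix \<sigma> n x assume s: "\<sigma> permutes {..<n}" and x: "x \<in> Obj (Lev A n)"
    show "?\<alpha> n (ActO A n \<sigma> x) = ActA E n \<sigma> (?\<alpha> n x)"
      unfolding F.onObj_ActO[OF s x] G.onObj_ActO[OF s x]
      by (rule arrow_eqI[OF ActA_Hom[OF s \<alpha>[OF x]]])
  qed
qed

lemma isomorphic_over: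
  assumes F: "cat_operad_morphism A E F" and G: "cat_operad_morphism A E G"
    and over: "\<And>n x. x \<in> Obj (Lev A n) \<Longrightarrow> p n (onObj F n x) = p n (onObj G n x)"
  shows "isomorphic_morphisms A E F G"
proof -
  have inv: "Cmp (Lev E n) (arrow n y x) (arrow n x y) = Id (Lev E n) x"
    if "x \<in> Obj (Lev E n)" "y \<in> Obj (Lev E n)" "p n x = p n y" for n x y
    using category.cmp_closed[OF lev_category arrow_Hom[OF that] arrow_Hom[OF that(2,1) that(3)[symmetric]]]
      category.id_closed[OF lev_category that(1)]
    by (rule parallel_eq)
  show ?thesis
    unfolding isomorphic_morphisms_def
    using transformation_over[OF F G over] transformation_over[OF G F over[symmetric]]
      over inv cat_operad_morphism.onObj_Obj[OF F] cat_operad_morphism.onObj_Obj[OF G]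
    by (intro exI conjI allI ballI) auto
qed

end

text \<open>
  The hom-sets of a discrete category are singletons on the diagonal and empty elsewhere; full
  faithfulness transports this to \<open>E\<close>.
\<close>

lemma chaotic_fibres_of_full_faithful:
  assumes f: "cat_operad_morphism E (disc P) f" and ff: "lev_full_faithful E (disc P) f"
  shows "chaotic_fibres E (onObj f)"
proof -
  interpret f: cat_operad_morphism E "disc P" f by (rule f)
  have Hom_disc: "Hom (Lev (disc P) n) a b = (if a = b \<and> a \<in> Ops P n then {a} else {})" for n a b
    by (auto simp: disc_def disc_cat_def Hom_def)
  have bij: "bij_betw (onArr f n) (Hom (Lev E n) x y) (Hom (Lev (disc P) n) (onObj f n x) (onObj f n y))"
    if "x \<in> Obj (Lev E n)" "y \<in> Obj (Lev E n)" for n x y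
    using ff that by (simp add: lev_full_faithful_def full_faithful_def)
  show ?thesis
  proof
    show "onObj f n x = onObj f n y" if "u \<in> Hom (Lev E n) x y" for u n x y
      using f.onArr_Hom[OF that] unfolding Hom_disc by (auto split: if_splits)
    fix n x y assume x: "x \<in> Obj (Lev E n)" and y: "y \<in> Obj (Lev E n)"
      and "onObj f n x = onObj f n y"
    moreover have "onObj f n x \<in> Ops P n"
      using f.onObj_Obj[OF x] by (simp add: disc_def disc_cat_def)
    ultimately have "bij_betw (onArr f n) (Hom (Lev E n) x y) {onObj f n x}"
      using bij[OF x y] by (simp add: Hom_disc)
    then have "card (Hom (Lev E n) x y) = 1"
      by (simp add: bij_betw_same_card)
    then show "\<exists>!u. u \<in> Hom (Lev E n) x y"
      by (auto simp: card_1_singleton_iff)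
  qed
qed

text \<open>
  Both composites of the extensions of \<open>g\<close> and \<open>h\<close> are endomorphisms over the base, as are the
  identities, so \<open>isomorphic_over\<close> supplies both isomorphisms.
\<close>

lemma equivalent_over:
  assumes A: "chaotic_fibres A p" and B: "chaotic_fibres B q"
    and g: "operad_morphism (obj_operad A) (obj_operad B) g"
    and g_over: "\<And>n x. x \<in> Obj (Lev A n) \<Longrightarrow> q n (g n x) = p n x"
    and h: "operad_morphism (obj_operad B) (obj_operad A) h"
    and h_over: "\<And>n x. x \<in> Obj (Lev B n) \<Longrightarrow> p n (h n x) = q n x"
  shows "cat_operad_equivalent A B"
proof -
  interpret A: chaotic_fibres A p by (rule A)
  interpret B: chaotic_fibres B q by (rule B)
  obtain F where F: "cat_operad_morphism A B F" and Fg: "onObj F = g"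
    using B.extend_obj_morphism[OF A g g_over] by blast
  obtain G where G: "cat_operad_morphism B A G" and Gh: "onObj G = h"
    using A.extend_obj_morphism[OF B h h_over] by blast
  have "isomorphic_morphisms A A (comp_morphism G F) id_morphism"
    using g_over h_over cat_operad_morphism.onObj_Obj[OF F]
    by (intro A.isomorphic_over comp_cat_operad_morphism[OF F G]
        id_cat_operad_morphism A.sym_cat_operad_axioms)
      (simp add: comp_morphism_def id_morphism_def Fg Gh)
  moreover have "isomorphic_morphisms B B (comp_morphism F G) id_morphism"
    using g_over h_over cat_operad_morphism.onObj_Obj[OF G]
    by (intro B.isomorphic_over comp_cat_operad_morphism[OF G F]
        id_cat_operad_morphism B.sym_cat_operad_axioms)
      (simp add: comp_morphism_def id_morphism_def Fg Gh)
  ultimately show ?thesis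
    unfolding cat_operad_equivalent_def using F G by blast
qed


section \<open>Projectivity of free operads\<close>

text \<open>A preimage is chosen for the value at each generator; freeness does the rest.\<close>

lemma free_operad_projective:
  assumes k: "operad_morphism (free_operad \<Phi>) B k" and e: "operad_morphism A B e"
    and surj: "\<And>n. e n ` Ops A n = Ops B n"
  obtains g where "operad_morphism (free_operad \<Phi>) A g"
    and "\<And>n x. x \<in> Ops (free_operad \<Phi>) n \<Longrightarrow> e n (g n x) = k n x"
proof -
  interpret k: operad_morphism "free_operad \<Phi>" B k by (rule k)
  interpret e: operad_morphism A B e by (rule e)
  let ?h = "\<lambda>n s. SOME a. a \<in> Ops A n \<and> e n a = k n (free_gen \<Phi> n s)"
  have h: "?h n s \<in> Ops A n \<and> e n (?h n s) = k n (free_gen \<Phi> n s)" if s: "s \<in> \<Phi> n" for n s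
  proof (rule someI_ex)
    have "free_gen \<Phi> n s \<in> Ops (free_operad \<Phi>) n"
      unfolding Ops_free_iff free_gen_def using s by (blast intro: repr_tclass wt_gen)
    from k.maps[OF this] show "\<exists>a. a \<in> Ops A n \<and> e n a = k n (free_gen \<Phi> n s)"
      using surj[of n] by force
  qed
  let ?g = "free_ext A ?h"
  have g: "operad_morphism (free_operad \<Phi>) A ?g"
    using h by (intro e.P.free_ext_morphism) blast
  have "?g n (free_gen \<Phi> n s) = ?h n s" if "s \<in> \<Phi> n" for n s
    using h that by (intro e.P.free_ext_gen) blast
  then have "fam_eq (free_operad \<Phi>) (\<lambda>n. e n \<circ> ?g n) k"
    using h by (intro free_morphism_unique[OF comp_operad_morphism[OF g e] k]) simp
  then show ?thesis using that[OF g] by (simp add: fam_eq_def)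
qed

lemma inverse_operad_morphism:
  assumes b: "operad_morphism A B b" and bij: "\<And>n. bij_betw (b n) (Ops A n) (Ops B n)"
  shows "operad_morphism B A (\<lambda>n. inv_into (Ops A n) (b n))" (is "operad_morphism B A ?c")
proof -
  interpret b: operad_morphism A B b by (rule b)
  have c: "?c n y \<in> Ops A n" "b n (?c n y) = y" if "y \<in> Ops B n" for n y
    using bij[of n] that by (auto simp: bij_betw_def inv_into_into f_inv_into_f)
  have cI: "?c n y = x" if "x \<in> Ops A n" "b n x = y" for n x y
    using bij[of n] that by (auto simp: bij_betw_def inv_into_f_f)
  show ?thesis
  proof
    fix y ks ys assume y: "y \<in> Ops B (length ks)" and ys: "list_all2 (\<lambda>k y. y \<in> Ops B k) ks ys"
    have cys: "list_all2 (\<lambda>k x. x \<in> Ops A k) ks (map2 ?c ks ys)" "map2 b ks (map2 ?c ks ys) = ys"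
      using ys c by (auto simp: list_all2_conv_all_nth intro!: nth_equalityI)
    show "?c (sum_list ks) (Compose B ks y ys) = Compose A ks (?c (length ks) y) (map2 ?c ks ys)"
      using b.P.compose_closed[OF c(1)[OF y] cys(1)] b.pres_compose[OF c(1)[OF y] cys(1)] c(2)[OF y] cys(2)
      by (intro cI) simp_all
  qed (use c b.P.unit_closed b.pres_unit b.P.act_closed b.pres_act in \<open>auto intro!: cI\<close>)
qed


section \<open>Equivalence of categorifications\<close>

text \<open>
  Bijectivity on objects makes \<open>b\<close> an isomorphism from the free operad to the object operad of
  \<open>Q\<close>, so projectivity carries over along its inverse.
\<close>

lemma obj_operad_projective:
  assumes b: "cat_operad_morphism (disc (free_operad \<Phi>)) Q b"
    and bij: "lev_bij_on_objects (disc (free_operad \<Phi>)) Q b"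
    and k: "operad_morphism (obj_operad Q) B k" and e: "operad_morphism A B e"
    and surj: "\<And>n. e n ` Ops A n = Ops B n"
  obtains g where "operad_morphism (obj_operad Q) A g"
    and "\<And>n x. x \<in> Obj (Lev Q n) \<Longrightarrow> e n (g n x) = k n x"
proof -
  let ?F = "free_operad \<Phi>"
  have bO: "operad_morphism ?F (obj_operad Q) (onObj b)"
    using cat_operad_morphism.obj_morphism[OF b] by (simp add: obj_operad_disc)
  have bb: "bij_betw (onObj b n) (Ops ?F n) (Obj (Lev Q n))" for n
    using bij by (simp add: lev_bij_on_objects_def disc_def disc_cat_def)
  then have "bij_betw (onObj b n) (Ops ?F n) (Ops (obj_operad Q) n)" for n
    by (simp add: obj_operad_def)
  from inverse_operad_morphism[OF bO this]
  have c: "operad_morphism (obj_operad Q) ?F (\<lambda>n. inv_into (Ops ?F n) (onObj b n))"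
      (is "operad_morphism _ _ ?c") .
  obtain g where g: "operad_morphism ?F A g"
    and eg: "\<And>n x. x \<in> Ops ?F n \<Longrightarrow> e n (g n x) = (k n \<circ> onObj b n) x"
    using free_operad_projective[OF comp_operad_morphism[OF bO k] e surj] by blast
  have "e n ((g n \<circ> ?c n) x) = k n x" if "x \<in> Obj (Lev Q n)" for n x
    using eg[of "?c n x" n] bb[of n] that by (simp add: bij_betw_def inv_into_into f_inv_into_f)
  then show ?thesis using that[OF comp_operad_morphism[OF c g]] by blast
qed

lemma categorification_surjective:
  assumes \<phi>: "signature P \<Phi> \<phi>"
    and b: "cat_operad_morphism (disc (free_operad \<Phi>)) Q b"
    and f: "cat_operad_morphism Q (disc P) f"
    and fb: "morphism_eq (disc (free_operad \<Phi>)) (comp_morphism f b) (disc_morphism \<phi>)"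
  shows "onObj f n ` Obj (Lev Q n) = Ops P n"
proof
  show "onObj f n ` Obj (Lev Q n) \<subseteq> Ops P n"
    using cat_operad_morphism.onObj_Obj[OF f, of _ n] by (auto simp: disc_def disc_cat_def)
  have "onObj f n (onObj b n x) = \<phi> n x" and "onObj b n x \<in> Obj (Lev Q n)"
    if "x \<in> Ops (free_operad \<Phi>) n" for x
    using that fb cat_operad_morphism.onObj_Obj[OF b, of x n]
    by (simp_all add: morphism_eq_def fam_eq_def obj_operad_disc comp_morphism_def disc_morphism_def)
      (simp add: disc_def disc_cat_def)
  moreover have "Ops P n = \<phi> n ` Ops (free_operad \<Phi>) n"
    using \<phi> by (simp add: signature_def regular_epi_iff)
  ultimately show "Ops P n \<subseteq> onObj f n ` Obj (Lev Q n)" by force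
qed

theorem categorifications_equivalent:
  assumes \<phi>: "signature P \<Phi> \<phi>" and Q: "is_categorification P \<Phi> \<phi> Q"
    and \<psi>: "signature P \<Psi> \<psi>" and W: "is_categorification P \<Psi> \<psi> W"
  shows "cat_operad_equivalent Q W"
proof -
  obtain b f where b: "cat_operad_morphism (disc (free_operad \<Phi>)) Q b"
      "lev_bij_on_objects (disc (free_operad \<Phi>)) Q b"
    and f: "cat_operad_morphism Q (disc P) f" "lev_full_faithful Q (disc P) f"
    and fb: "morphism_eq (disc (free_operad \<Phi>)) (comp_morphism f b) (disc_morphism \<phi>)"
    using Q unfolding is_categorification_def by blast
  obtain b' f' where b': "cat_operad_morphism (disc (free_operad \<Psi>)) W b'"
      "lev_bij_on_objects (disc (free_operad \<Psi>)) W b'"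
    and f': "cat_operad_morphism W (disc P) f'" "lev_full_faithful W (disc P) f'"
    and fb': "morphism_eq (disc (free_operad \<Psi>)) (comp_morphism f' b') (disc_morphism \<psi>)"
    using W unfolding is_categorification_def by blast
  have fO: "operad_morphism (obj_operad Q) P (onObj f)" "operad_morphism (obj_operad W) P (onObj f')"
    using cat_operad_morphism.obj_morphism[OF f(1)] cat_operad_morphism.obj_morphism[OF f'(1)]
    by (simp_all add: obj_operad_disc)
  have surj: "onObj f n ` Ops (obj_operad Q) n = Ops P n"
    "onObj f' n ` Ops (obj_operad W) n = Ops P n" for n
    using categorification_surjective[OF \<phi> b(1) f(1) fb]
      categorification_surjective[OF \<psi> b'(1) f'(1) fb'] by (simp_all add: obj_operad_def)
  obtain g where g: "operad_morphism (obj_operad Q) (obj_operad W) g"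
      "\<And>n x. x \<in> Obj (Lev Q n) \<Longrightarrow> onObj f' n (g n x) = onObj f n x"
    using obj_operad_projective[OF b fO surj(2)] by blast
  obtain h where h: "operad_morphism (obj_operad W) (obj_operad Q) h"
      "\<And>n x. x \<in> Obj (Lev W n) \<Longrightarrow> onObj f n (h n x) = onObj f' n x"
    using obj_operad_projective[OF b' fO(2,1) surj(1)] by blast
  show ?thesis
    using chaotic_fibres_of_full_faithful[OF f] chaotic_fibres_of_full_faithful[OF f'] g h
    by (rule equivalent_over)
qed

theorem theorem3p8:
  fixes P :: "'p operad"
    and \<Phi> :: "nat \<Rightarrow> 's set"
    and \<phi> :: "nat \<Rightarrow> 's opterm set \<Rightarrow> 'p"
    and Q :: "('o, 'm) cat_operad"
    and W :: "('o2, 'm2) cat_operad"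
  assumes "sym_operad P"
    and "signature P \<Phi> \<phi>"
    and "is_categorification P \<Phi> \<phi> Q"
    and "is_unbiased_categorification P W"
  shows "cat_operad_equivalent Q W"
  using categorifications_equivalent[OF assms(2,3) signature_counit[OF assms(1)]] assms(4)
  unfolding is_unbiased_categorification_def by blast

end
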